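(* Let $a>0$, and for complex $\beta$ let $V(0,0,a,\beta,x)=\int e^{-ax^{2}-\beta x}dx=\frac{\sqrt\pi}{2\sqrt a}e^{\frac{\beta^{2}}{4a}}\operatorname{erf}\left(\frac{2ax+\beta}{2\sqrt a}\right)$. With the convention $\sqrt{b^{2}x^{2}}=bx$ (see context), the following indefinite integrals in $x$ hold. (i) $$\sqrt{2\pi}\int x^{\frac12}e^{-ax^{2}}b^{\frac12}\mathbf{H}_{\frac12}(bx)\,dx=\sqrt{2\pi}\int\sqrt b\sqrt x\,e^{-ax^{2}}G_{1,3}^{1,1}\left(\frac{b^{2}x^{2}}{4}\,\Big|\begin{array}{c}\frac34\\ \frac34,-\frac14,\frac14\end{array}\right)dx$$ $$=-\int 2e^{-ax^{2}}(\cos(bx)-1)\,dx=-V(0,0,a,ib,x)-V(0,0,a,-ib,x)+2V(0,0,a,0,x).$$ (ii) $$\sqrt{2\pi}\int x^{\frac12}e^{-ax^{2}}b^{\frac12}\mathbf{L}_{\frac12}(bx)\,dx=-\int2\pi^{3/2}\sqrt b\sqrt x\,e^{-ax^{2}}G_{2,4}^{1,1}\left(\frac{b^{2}x^{2}}{4}\,\Big|\begin{array}{c}\frac34,\frac12\\ \frac34,\frac12,-\frac14,\frac14\end{array}\right)dx$$ $$=\int\left(2e^{-ax^{2}}\sinh(bx)+2e^{-ax^{2}-bx}-2e^{-ax^{2}}\right)dx=\int\left(2e^{-ax^{2}}\cosh(bx)-2e^{-ax^{2}}\right)dx$$ $$=V(0,0,a,b,x)+V(0,0,a,-b,x)-2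V(0,0,a,0,x).$$
   Context: $\mathbf{H}_\mu$ is the Struve function and $\mathbf{L}_\mu$ the modified Struve function; $G_{p,q}^{m,n}(z\,|\,\cdot)$ is the Meijer G-function, with the $p$ upper parameters in the first row and the $q$ lower parameters in the second; $\operatorname{erf}(z)=\frac{2}{\sqrt\pi}\int_0^z e^{-t^2}dt$ is the entire error function. Roots are read with $\sqrt{b^{2}x^{2}}=bx$ and $\sqrt{bx}=\sqrt b\sqrt x$ (automatic for $b,x>0$). Equalities of indefinite integrals mean that the integrands agree and that the final expression is an antiderivative of them in $x$. *)

theory Defs
  imports "HOL-Complex_Analysis.Complex_Analysis"
begin

definition erf :: "complex \<Rightarrow> complex" where
  "erf z = 2 / of_real (sqrt pi) * contour_integral (linepath 0 z) (\<lambda>t. exp (- (t ^ 2)))"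

(* The power series of the Struve functions; (z/2) powr (\<nu> + 1) takes the principal branch. *)

definition struve_H :: "complex \<Rightarrow> complex \<Rightarrow> complex" where
  "struve_H \<nu> z = (z / 2) powr (\<nu> + 1) *
     (\<Sum>k. (-1) ^ k * (z / 2) ^ (2 * k) * rGamma (of_nat k + 3 / 2) * rGamma (of_nat k + \<nu> + 3 / 2))"

definition struve_L :: "complex \<Rightarrow> complex \<Rightarrow> complex" where
  "struve_L \<nu> z = (z / 2) powr (\<nu> + 1) *
     (\<Sum>k. (z / 2) ^ (2 * k) * rGamma (of_nat k + 3 / 2) * rGamma (of_nat k + \<nu> + 3 / 2))"

definition V00 :: "real \<Rightarrow> complex \<Rightarrow> complex \<Rightarrow> complex" where
  "V00 a \<beta> x = of_real (sqrt pi) / (2 * of_real (sqrt a)) * exp (\<beta> ^ 2 / (4 * of_real a)) *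
     erf ((2 * of_real a * x + \<beta>) / (2 * of_real (sqrt a)))"


section \<open>The Meijer G-function\<close>

text \<open>
  The G-function is the Mellin-Barnes integral of \<open>meijer_integrand\<close> divided by \<open>2 \<pi> i\<close>.
  The lists \<open>as\<close> and \<open>bs\<close> are the upper and the lower parameters, so that
  \<open>p = length as\<close> and \<open>q = length bs\<close>; \<open>z powr s\<close> is the principal branch.
\<close>

definition meijer_integrand ::
  "nat \<Rightarrow> nat \<Rightarrow> complex list \<Rightarrow> complex list \<Rightarrow> complex \<Rightarrow> complex \<Rightarrow> complex" where
  "meijer_integrand m n as bs z s =
     (\<Prod>j<m. Gamma (bs ! j - s)) * (\<Prod>j<n. Gamma (1 - as ! j + s)) *
     (\<Prod>j=m..<length bs. rGamma (1 - bs ! j + s)) * (\<Prod>j=n..<length as. rGamma (as ! j - s)) *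
     z powr s"

definition meijer_poles_b :: "nat \<Rightarrow> complex list \<Rightarrow> complex set" where
  "meijer_poles_b m bs = {bs ! j + of_nat k | j k. j < m}"

definition meijer_poles_a :: "nat \<Rightarrow> complex list \<Rightarrow> complex set" where
  "meijer_poles_a n as = {as ! j - 1 - of_nat k | j k. j < n}"

text \<open>
  There are three customary kinds of contour:

  \<^item> \<open>Vertical\<close>: from \<open>-i\<infinity>\<close> to \<open>+i\<infinity>\<close>;
  \<^item> \<open>Right_Loop\<close>: a loop that starts and ends at infinity on lines parallel to the positive real
    axis and encircles the poles of the factors \<open>\<Gamma>(b\<^sub>j - s)\<close> once in the negative sense;
  \<^item> \<open>Left_Loop\<close>: a loop that starts and ends at infinity on lines parallel to the negative real
    axis and encircles the poles of the factors \<open>\<Gamma>(1 - a\<^sub>j + s)\<close> once in the positive sense.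

  Each kind separates the poles of the \<open>\<Gamma>(b\<^sub>j - s)\<close> from those of the \<open>\<Gamma>(1 - a\<^sub>j + s)\<close>.
  A contour is given by a finite path \<open>g\<close>, to which two straight rays to infinity are attached.
  Cutting the rays off at abscissa (or ordinate) \<open>\<plusminus>T\<close> gives \<open>mb_contour\<close>. To express on
  which side of the contour a pole lies, the cut contour is closed up by \<open>mb_closing\<close>:
  by a vertical segment for a loop, by three sides of a rectangle in the right half-plane for a
  vertical contour. For large \<open>T\<close> the winding number of the resulting closed path about a
  pole of modulus less than \<open>T\<close> tells whether, and in which sense, the pole is encircled.
\<close>

datatype mb_kind = Vertical | Right_Loop | Left_Loop

fun mb_start :: "mb_kind \<Rightarrow> (real \<Rightarrow> complex) \<Rightarrow> real \<Rightarrow> complex" where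
  "mb_start Vertical g T = Complex (Re (pathstart g)) (- T)"
| "mb_start Right_Loop g T = Complex T (Im (pathstart g))"
| "mb_start Left_Loop g T = Complex (- T) (Im (pathstart g))"

fun mb_finish :: "mb_kind \<Rightarrow> (real \<Rightarrow> complex) \<Rightarrow> real \<Rightarrow> complex" where
  "mb_finish Vertical g T = Complex (Re (pathfinish g)) T"
| "mb_finish Right_Loop g T = Complex T (Im (pathfinish g))"
| "mb_finish Left_Loop g T = Complex (- T) (Im (pathfinish g))"

definition mb_contour :: "mb_kind \<Rightarrow> (real \<Rightarrow> complex) \<Rightarrow> real \<Rightarrow> real \<Rightarrow> complex" where
  "mb_contour K g T =
     linepath (mb_start K g T) (pathstart g) +++ g +++ linepath (pathfinish g) (mb_finish K g T)"

definition mb_closing :: "mb_kind \<Rightarrow> (real \<Rightarrow> complex) \<Rightarrow> real \<Rightarrow> real \<Rightarrow> complex" where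
  "mb_closing K g T =
     (if K = Vertical
      then linepath (mb_finish K g T) (Complex T T) +++ linepath (Complex T T) (Complex T (- T)) +++
           linepath (Complex T (- T)) (mb_start K g T)
      else linepath (mb_finish K g T) (mb_start K g T))"

definition mb_admissible ::
  "mb_kind \<Rightarrow> nat \<Rightarrow> nat \<Rightarrow> complex list \<Rightarrow> complex list \<Rightarrow> (real \<Rightarrow> complex) \<Rightarrow> bool" where
  "mb_admissible K m n as bs g \<longleftrightarrow>
     valid_path g \<and>
     (\<forall>\<^sub>F T in at_top.
        path_image (mb_contour K g T) \<inter> (meijer_poles_b m bs \<union> meijer_poles_a n as) = {} \<and>
        (\<forall>w\<in>meijer_poles_b m bs. cmod w < T \<longrightarrow>
           winding_number (mb_contour K g T +++ mb_closing K g T) w =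
             (if K = Left_Loop then 0 else - 1)) \<and>
        (\<forall>w\<in>meijer_poles_a n as. cmod w < T \<longrightarrow>
           winding_number (mb_contour K g T +++ mb_closing K g T) w =
             (if K = Left_Loop then 1 else 0)))"

text \<open>The usual conditions for convergence; where two of them hold, the integrals agree.\<close>

fun mb_converges :: "mb_kind \<Rightarrow> nat \<Rightarrow> nat \<Rightarrow> nat \<Rightarrow> nat \<Rightarrow> complex \<Rightarrow> bool" where
  "mb_converges Vertical m n p q z \<longleftrightarrow>
     p + q < 2 * (m + n) \<and> \<bar>Arg z\<bar> < (real m + real n - (real p + real q) / 2) * pi"
| "mb_converges Right_Loop m n p q z \<longleftrightarrow> p < q \<or> (p = q \<and> 1 \<le> p \<and> cmod z < 1)"
| "mb_converges Left_Loop m n p q z \<longleftrightarrow> q < p \<or> (p = q \<and> 1 \<le> p \<and> 1 < cmod z)"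

definition has_meijer_G ::
  "nat \<Rightarrow> nat \<Rightarrow> complex list \<Rightarrow> complex list \<Rightarrow> complex \<Rightarrow> complex \<Rightarrow> bool" where
  "has_meijer_G m n as bs z w \<longleftrightarrow>
     n \<le> length as \<and> m \<le> length bs \<and> z \<noteq> 0 \<and>
     (\<exists>K g. mb_converges K m n (length as) (length bs) z \<and> mb_admissible K m n as bs g \<and>
        ((\<lambda>T. contour_integral (mb_contour K g T) (meijer_integrand m n as bs z) / (2 * of_real pi * \<i>))
           \<longlongrightarrow> w) at_top)"

definition meijer_G ::
  "nat \<Rightarrow> nat \<Rightarrow> complex list \<Rightarrow> complex list \<Rightarrow> complex \<Rightarrow> complex" where
  "meijer_G m n as bs z = (THE w. has_meijer_G m n as bs z w)"

end

theory Submission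
  imports Defs
begin

text \<open>
  By Legendre's duplication formula the series of \<open>\<^bold>H\<close> and \<open>\<^bold>L\<close> of order \<open>1/2\<close> are, up to a
  constant and the factor \<open>(w/2)\<^sup>3\<^sup>/\<^sup>2 / w\<^sup>2\<close>, those of \<open>1 - cos w\<close> and \<open>cosh w - 1\<close>.
  Both G-functions are sums of residues: under \<open>s \<mapsto> s + 1\<close> the integrand \<open>F\<close> gains a factor
  \<open>O(1 / Re s)\<close>, so \<open>F\<close> decays like \<open>C\<^sup>n / n!\<close> along the translates of any compact set free of poles.
  Hence the segment that closes a right loop midway between two poles contributes nothing in the
  limit, and the residue theorem gives the same value for every admissible loop. The rectangular
  loop through \<open>\<plusminus>\<i>\<close> shows that the limit exists.
\<close>

section \<open>The error function and the Struve functions of order 1/2\<close>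

text \<open>The integrand is entire, so it has a primitive \<open>g\<close> on the whole plane, and
  the integral along the segment is \<open>g z - g 0\<close>.\<close>

lemma erf_has_field_derivative:
  "(erf has_field_derivative 2 / of_real (sqrt pi) * exp (- (z ^ 2))) (at z)"
proof -
  have "(\<lambda>t::complex. exp (- (t ^ 2))) holomorphic_on UNIV"
    by (intro holomorphic_intros)
  then obtain g :: "complex \<Rightarrow> complex"
    where g: "\<And>x. (g has_field_derivative exp (- (x ^ 2))) (at x)"
    using holomorphic_convex_primitive'[of UNIV] by auto
  have "contour_integral (linepath 0 z) (\<lambda>t. exp (- (t ^ 2))) = g z - g 0" for z
    using contour_integral_primitive[of UNIV g _ "linepath 0 z"] g
    by (intro contour_integral_unique) auto
  then have "erf = (\<lambda>z. 2 / of_real (sqrt pi) * (g z - g 0))"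
    by (simp add: erf_def fun_eq_iff)
  moreover have "((\<lambda>z. 2 / of_real (sqrt pi) * (g z - g 0)) has_field_derivative
      2 / of_real (sqrt pi) * exp (- (z ^ 2))) (at z)"
    by (rule derivative_eq_intros g refl)+ simp
  ultimately show ?thesis by simp
qed

lemma V00_has_field_derivative:
  assumes "a > 0"
  shows "(V00 a \<beta> has_field_derivative exp (- of_real a * x ^ 2 - \<beta> * x)) (at x)"
proof -
  \<comment> \<open>With \<open>a = r ^ 2\<close> all identities below are rational in
    \<open>r\<close>.\<close>
  define r :: complex where "r = of_real (sqrt a)"
  have r: "r \<noteq> 0" "of_real a = r ^ 2"
    using assms by (auto simp: r_def simp flip: of_real_power)
  define p :: complex where "p = of_real (sqrt pi)"
  have p: "p \<noteq> 0" by (simp add: p_def)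
  have lin: "((\<lambda>x. (2 * r ^ 2 * x + \<beta>) / (2 * r)) has_field_derivative r) (at x)"
    using r by (auto intro!: derivative_eq_intros simp: power2_eq_square field_simps)
  \<comment> \<open>Completing the square: the exponential prefactor of \<open>V00\<close> absorbs
    the constant that remains.\<close>
  have sq: "\<beta> ^ 2 / (4 * r ^ 2) + - (((2 * r ^ 2 * x + \<beta>) / (2 * r)) ^ 2) = - (r ^ 2) * x ^ 2 - \<beta> * x"
    using r(1) by (simp add: field_simps power2_eq_square)
  have "((\<lambda>x. p / (2 * r) * exp (\<beta> ^ 2 / (4 * r ^ 2)) * erf ((2 * r ^ 2 * x + \<beta>) / (2 * r)))
      has_field_derivative p / (2 * r) * exp (\<beta> ^ 2 / (4 * r ^ 2)) *
        (2 / p * exp (- (((2 * r ^ 2 * x + \<beta>) / (2 * r)) ^ 2)) * r)) (at x)"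
    using erf_has_field_derivative[folded p_def]
    by (intro DERIV_cmult DERIV_chain2[OF _ lin]) auto
  also have "p / (2 * r) * exp (\<beta> ^ 2 / (4 * r ^ 2)) *
        (2 / p * exp (- (((2 * r ^ 2 * x + \<beta>) / (2 * r)) ^ 2)) * r) =
      exp (\<beta> ^ 2 / (4 * r ^ 2)) * exp (- (((2 * r ^ 2 * x + \<beta>) / (2 * r)) ^ 2))"
    using p r(1) by (simp add: field_simps)
  also have "\<dots> = exp (- (r ^ 2) * x ^ 2 - \<beta> * x)"
    by (simp only: exp_add[symmetric] sq)
  finally show ?thesis
    unfolding V00_def[abs_def] r_def[symmetric] p_def[symmetric] r(2) by simp
qed

section \<open>Struve series of order 1/2\<close>

text \<open>Duplication at \<open>u = k + 3 / 2\<close>: here \<open>u + 1 / 2 = k + 2\<close> and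
  \<open>Gamma (2 * u)\<close> is the factorial of \<open>2 * k + 2\<close>, so the two Gamma
  factors of a Struve coefficient merge into one even factorial.\<close>

lemma rGamma_half_series_term:
  "rGamma (of_nat k + 3 / 2) * rGamma (of_nat k + 2 :: complex) =
     2 ^ (2 * k + 2) / (of_real (sqrt pi) * fact (2 * k + 2))"
proof -
  define u :: complex where "u = of_nat k + 3 / 2"
  have pos: "x \<notin> \<int>\<^sub>\<le>\<^sub>0" if "Re x > 0" for x :: complex
    using that by (auto elim!: nonpos_Ints_cases)
  have "Gamma u * Gamma (u + 1 / 2) =
      exp ((1 - 2 * u) * of_real (ln 2)) * of_real (sqrt pi) * Gamma (2 * u)"
    by (intro Gamma_legendre_duplication pos) (auto simp: u_def)
  moreover have "Gamma (2 * u) = fact (2 * k + 2)"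
    by (subst Gamma_fact[symmetric]) (simp add: u_def algebra_simps)
  moreover have "exp ((1 - 2 * u) * of_real (ln 2)) = 1 / 2 ^ (2 * k + 2)"
  proof -
    have "(1 - 2 * u) * of_real (ln 2) = - (of_nat (2 * k + 2) * of_real (ln 2))"
      by (simp add: u_def algebra_simps)
    then show ?thesis
      by (simp only: exp_minus exp_of_nat_mult exp_of_real) (simp add: inverse_eq_divide)
  qed
  moreover have "rGamma u * rGamma (u + 1 / 2) = inverse (Gamma u * Gamma (u + 1 / 2))"
    by (simp add: rGamma_inverse_Gamma)
  ultimately have "rGamma u * rGamma (u + 1 / 2) =
      inverse (1 / 2 ^ (2 * k + 2) * of_real (sqrt pi) * fact (2 * k + 2))"
    by (simp only:)
  moreover have "u + 1 / 2 = of_nat k + 2" by (simp add: u_def)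
  ultimately show ?thesis
    by (simp only: u_def) (simp add: inverse_eq_divide)
qed

text \<open>The term of index \<open>k\<close> is the term of index \<open>k + 1\<close> of the
  series of \<open>cosh w\<close>, divided by \<open>w ^ 2\<close> up to a constant; removing the
  constant term 1 accounts for \<open>cosh w - 1\<close>.\<close>

lemma struve_L_half_series:
  fixes w :: complex
  assumes "w \<noteq> 0"
  shows "(\<lambda>k. (w / 2) ^ (2 * k) * rGamma (of_nat k + 3 / 2) * rGamma (of_nat k + 1 / 2 + 3 / 2))
           sums (4 / (of_real (sqrt pi) * w ^ 2) * (cosh w - 1))"
proof -
  have "(\<lambda>n. if even n then w ^ n /\<^sub>R fact n else 0) sums cosh w"
    by (rule cosh_converges)
  then have "(\<lambda>k. w ^ (2 * k) /\<^sub>R fact (2 * k)) sums cosh w"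
    by (subst (asm) sums_mono_reindex[of "\<lambda>k. 2 * k", symmetric])
       (auto simp: strict_mono_def elim!: evenE)
  then have "(\<lambda>k. w ^ (2 * Suc k) /\<^sub>R fact (2 * Suc k)) sums (cosh w - 1)"
    by (subst sums_Suc_iff) simp
  then have "(\<lambda>k. 4 / (of_real (sqrt pi) * w ^ 2) * (w ^ (2 * Suc k) /\<^sub>R fact (2 * Suc k)))
      sums (4 / (of_real (sqrt pi) * w ^ 2) * (cosh w - 1))"
    by (rule sums_mult)
  moreover have "4 / (of_real (sqrt pi) * w ^ 2) * (w ^ (2 * Suc k) /\<^sub>R fact (2 * Suc k)) =
      (w / 2) ^ (2 * k) * rGamma (of_nat k + 3 / 2) * rGamma (of_nat k + 1 / 2 + 3 / 2)" for k
  proof -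
    have "(w / 2) ^ (2 * k) * rGamma (of_nat k + 3 / 2) * rGamma (of_nat k + 1 / 2 + 3 / 2) =
        (w / 2) ^ (2 * k) * (rGamma (of_nat k + 3 / 2) * rGamma (of_nat k + 2))"
      by (simp add: add.assoc)
    also have "\<dots> = (w / 2) ^ (2 * k) * (2 ^ (2 * k + 2) / (of_real (sqrt pi) * fact (2 * k + 2)))"
      by (simp only: rGamma_half_series_term)
    also have "\<dots> = 4 / (of_real (sqrt pi) * w ^ 2) * (w ^ (2 * k) * w ^ 2 / fact (2 * k + 2))"
      using assms by (simp add: power_divide power_add field_simps del: fact_Suc)
    also have "w ^ (2 * k) * w ^ 2 / fact (2 * k + 2) = w ^ (2 * Suc k) /\<^sub>R fact (2 * Suc k)"
      by (simp add: scaleR_conv_of_real divide_inverse power2_eq_square mult_ac del: fact_Suc)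
    finally show ?thesis by (rule sym)
  qed
  ultimately show ?thesis by simp
qed

text \<open>The previous series at \<open>\<i> * w\<close>: the even powers of \<open>\<i>\<close>
  supply the alternating sign, and \<open>cosh (\<i> * w) = cos w\<close>.\<close>

lemma struve_H_half_series:
  fixes w :: complex
  assumes "w \<noteq> 0"
  shows "(\<lambda>k. (-1) ^ k * (w / 2) ^ (2 * k) * rGamma (of_nat k + 3 / 2) * rGamma (of_nat k + 1 / 2 + 3 / 2))
           sums (4 / (of_real (sqrt pi) * w ^ 2) * (1 - cos w))"
proof -
  have "(\<i> * w / 2) ^ (2 * k) = (-1) ^ k * (w / 2) ^ (2 * k)" for k
  proof -
    have "(\<i> * w / 2) ^ (2 * k) = (\<i> ^ 2 * (w / 2) ^ 2) ^ k"
      unfolding power_mult by (simp only: power_mult_distrib[symmetric]) simp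
    also have "\<dots> = (-1) ^ k * (w / 2) ^ (2 * k)"
      by (simp only: power_mult_distrib power2_i power_mult)
    finally show ?thesis .
  qed
  moreover have "4 / (of_real (sqrt pi) * (\<i> * w) ^ 2) * (cosh (\<i> * w) - 1) =
      4 / (of_real (sqrt pi) * w ^ 2) * (1 - cos w)"
    by (simp add: cosh_conv_cos power_mult_distrib divide_simps flip: mult.assoc)
  ultimately show ?thesis
    using struve_L_half_series[of "\<i> * w"] assms by simp
qed

text \<open>Division by the positive number 2 does not affect the branch, so the exponents 1/2 and
  3/2 add up to 2 for every nonzero \<open>w\<close>, whatever its argument.\<close>

lemma powr_three_halves_mult_csqrt:
  assumes "w \<noteq> 0"
  shows "csqrt w * (w / 2) powr (1 / 2 + 1) = of_real (sqrt 2) * (w ^ 2 / 4)"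
proof -
  have w2: "w / 2 = of_real (1 / 2) * w" by simp
  have h: "(w / 2) powr (1 / 2) = csqrt w / of_real (sqrt 2)"
    unfolding w2 by (subst powr_times_real_left)
     (auto simp: csqrt_conv_powr[symmetric] real_sqrt_divide)
  have "csqrt w * (w / 2) powr (1 / 2 + 1) = (csqrt w) ^ 2 * (w / 2) / of_real (sqrt 2)"
    using assms by (simp only: powr_add h) (simp add: power2_eq_square mult_ac)
  also have "\<dots> = w ^ 2 / (2 * of_real (sqrt 2))"
    unfolding power2_csqrt by (simp add: power2_eq_square)
  also have "\<dots> = of_real (sqrt 2) * (w ^ 2 / 4)"
    by (simp add: field_simps flip: of_real_mult)
  finally show ?thesis .
qed

section \<open>Right loops and residue series\<close>

text \<open>If the first upper and the first lower parameter both equal \<open>c\<close>, the poles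
  of the two Gamma factors lie on this single translate of the integers.\<close>

definition shifted_Ints :: "real \<Rightarrow> complex set" where
  "shifted_Ints c = (\<lambda>n. of_real c + n) ` \<int>"

lemma closed_shifted_Ints: "closed (shifted_Ints c)"
  unfolding shifted_Ints_def by (intro closed_translation closed_Ints)

lemma shifted_Ints_iff: "s \<in> shifted_Ints c \<longleftrightarrow> s - of_real c \<in> \<int>"
  by (force simp: shifted_Ints_def image_iff)

lemma shifted_Ints_altdef: "shifted_Ints c = range (\<lambda>n. of_real (c + of_int n))"
  by (auto simp: shifted_Ints_def Ints_def)

lemma shifted_Ints_plus_of_nat: "s + of_nat n \<in> shifted_Ints c \<longleftrightarrow> s \<in> shifted_Ints c"
  using add_in_Ints_iff_right[of "of_nat n" "s - of_real c"]
  by (simp add: shifted_Ints_iff algebra_simps)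

text \<open>Such abscissas lie midway between neighbouring points of \<open>c + \<int>\<close>.
  Doubling turns membership into the equality of an even and an odd integer.\<close>

lemma half_integer_shift_not_shifted_Ints:
  assumes "Re s = c + 1 / 2 + of_nat N"
  shows "s \<notin> shifted_Ints c"
proof
  assume "s \<in> shifted_Ints c"
  then obtain n :: int where "s = of_real (c + of_int n)" by (auto simp: shifted_Ints_altdef)
  then have "c + of_int n = c + 1 / 2 + of_nat N" using assms by simp
  then have "of_int (2 * n) = (of_int (1 + 2 * int N) :: real)" by simp
  then have "2 * n = 1 + 2 * int N" by (simp only: of_int_eq_iff)
  then show False by presburger
qed

text \<open>With \<open>p < q\<close> and \<open>4 \<le> p + q\<close>, a right loop is the only contour for which the integral
  converges when \<open>m = n = 1\<close>. The poles of the integrand are the points of \<open>c + \<int>\<close>.\<close>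

locale meijer_right_loop =
  fixes as bs :: "complex list" and z :: complex and c C :: real
  assumes lengths: "0 < length as" "length as < length bs" "4 \<le> length as + length bs"
    and params: "as ! 0 = of_real c" "bs ! 0 = of_real c"
    and c: "0 < c" "c < 1"
    and z: "z \<noteq> 0"
    and C: "0 \<le> C"
    and shift_bound: "\<And>s. 1 \<le> Re s \<Longrightarrow> s \<notin> shifted_Ints c \<Longrightarrow>
      norm (meijer_integrand 1 1 as bs z (s + 1)) \<le> C / Re s * norm (meijer_integrand 1 1 as bs z s)"
begin

abbreviation F :: "complex \<Rightarrow> complex" where "F \<equiv> meijer_integrand 1 1 as bs z"

lemma poles_b: "meijer_poles_b 1 bs = range (\<lambda>k. of_real (c + real k))"
  by (auto simp: meijer_poles_b_def params)

lemma poles_a: "meijer_poles_a 1 as = range (\<lambda>k. of_real (c - 1 - real k))"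
  by (auto simp: meijer_poles_a_def params)

text \<open>Because the parameters coincide, the two families are the nonnegative and the negative
  half of one arithmetic progression.\<close>

lemma poles: "meijer_poles_b 1 bs \<union> meijer_poles_a 1 as = shifted_Ints c"
proof -
  have "of_real (c + of_int n) \<in> meijer_poles_b 1 bs \<union> meijer_poles_a 1 as" for n :: int
  proof (cases "n \<ge> 0")
    case True
    then have "c + of_int n = c + real (nat n)" by simp
    then show ?thesis unfolding poles_b by (metis UnI1 rangeI)
  next
    case False
    then have "c + of_int n = c - 1 - real (nat (- n - 1))" by simp
    then show ?thesis unfolding poles_a by (metis UnI2 rangeI)
  qed
  moreover have "c + real k = c + of_int (int k)" "c - 1 - real k = c + of_int (- 1 - int k)" for k
    by simp_all
  then have "meijer_poles_b 1 bs \<union> meijer_poles_a 1 as \<subseteq> shifted_Ints c"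
    unfolding poles_a poles_b shifted_Ints_altdef by (metis (no_types, lifting) Un_least image_subsetI rangeI)
  ultimately show ?thesis
    by (auto simp: shifted_Ints_altdef)
qed

text \<open>The reciprocal Gamma factors and \<open>z powr s\<close> are entire in \<open>s\<close>,
  so only the two Gamma factors restrict the domain.\<close>

lemma holomorphic_integrand: "F holomorphic_on - shifted_Ints c"
proof -
  have "of_real c - s \<notin> \<int>" "1 - of_real c + s \<notin> \<int>" if "s \<notin> shifted_Ints c" for s
  proof -
    have "s - of_real c \<notin> \<int>" using that by (simp add: shifted_Ints_iff)
    moreover have "of_real c - s = - (s - of_real c)" "1 - of_real c + s = 1 + (s - of_real c)"
      by simp_all
    ultimately show "of_real c - s \<notin> \<int>" "1 - of_real c + s \<notin> \<int>"
      by (simp_all only: minus_in_Ints_iff add_in_Ints_iff_left[OF Ints_1] not_False_eq_True)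
  qed
  then show ?thesis
    unfolding meijer_integrand_def using z
    by (auto intro!: holomorphic_intros simp: params dest: nonpos_Ints_Int)
qed

lemma continuous_on_integrand: "continuous_on (- shifted_Ints c) F"
  by (intro holomorphic_on_imp_continuous_on holomorphic_integrand)

lemma contour_integrable:
  assumes "valid_path \<gamma>" "path_image \<gamma> \<inter> shifted_Ints c = {}"
  shows "F contour_integrable_on \<gamma>"
  using assms closed_shifted_Ints
  by (intro contour_integrable_holomorphic_simple[OF holomorphic_integrand]) auto

text \<open>On \<open>K\<close> the integrand is bounded by some \<open>M\<close>. Iterating
  \<open>shift_bound\<close> from abscissas at least 1 gives factors of at most
  \<open>C / (j + 1)\<close>, whose product is the general term of an exponential series.\<close>

lemma tail_bound:
  assumes "compact K" "\<And>s. s \<in> K \<Longrightarrow> 1 \<le> Re s \<and> s \<notin> shifted_Ints c"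
  obtains e where "e \<longlonglongrightarrow> 0" "\<And>n. 0 \<le> e n" "\<And>s n. s \<in> K \<Longrightarrow> norm (F (s + of_nat n)) \<le> e n"
proof -
  have "compact (F ` K)"
    using assms by (intro compact_continuous_image continuous_on_subset[OF continuous_on_integrand]) auto
  then obtain M where M: "0 < M" "\<And>s. s \<in> K \<Longrightarrow> norm (F s) \<le> M"
    using compact_imp_bounded[of "F ` K"] by (auto simp: bounded_pos)
  show thesis
  proof
    have "(\<lambda>n. M * (C ^ n /\<^sub>R fact n)) \<longlonglongrightarrow> M * 0"
      by (intro tendsto_mult tendsto_const summable_LIMSEQ_zero summable_exp_generic)
    then show "(\<lambda>n. M * (C ^ n / fact n)) \<longlonglongrightarrow> 0"
      by (simp add: divide_inverse mult_ac)
    show "0 \<le> M * (C ^ n / fact n)" for n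
      using M C by simp
    show "norm (F (s + of_nat n)) \<le> M * (C ^ n / fact n)" if "s \<in> K" for s n
    proof (induction n)
      case 0
      then show ?case using M(2)[OF that] by simp
    next
      case (Suc n)
      have s: "1 \<le> Re s" "s \<notin> shifted_Ints c" using assms(2)[OF that] by auto
      have "norm (F (s + of_nat n + 1)) \<le> C / Re (s + of_nat n) * norm (F (s + of_nat n))"
        using s by (intro shift_bound) (auto simp: shifted_Ints_plus_of_nat)
      also have "\<dots> \<le> C / (real n + 1) * (M * (C ^ n / fact n))"
        using s C Suc by (intro mult_mono divide_left_mono) auto
      finally show ?case by (simp add: add_ac field_simps)
    qed
  qed
qed

section \<open>Residues inside a closed right loop\<close>

text \<open>The residue theorem in a vertical strip, which contains only finitely many poles; those
  on the right count with weight -1, those on the left with weight 0.\<close>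

lemma contour_integral_closed:
  fixes N :: nat
  defines "T \<equiv> c + 1 / 2 + real N"
  assumes "valid_path \<gamma>" "pathfinish \<gamma> = pathstart \<gamma>"
    and image: "path_image \<gamma> \<subseteq> {s. - T < Re s \<and> Re s < T + 1 / 2} - shifted_Ints c"
    and winding_b: "\<And>k. k \<le> N \<Longrightarrow> winding_number \<gamma> (of_real (c + real k)) = - 1"
    and winding_a: "\<And>k. real k + 1 - c < T \<Longrightarrow> winding_number \<gamma> (of_real (c - 1 - real k)) = 0"
  shows "contour_integral \<gamma> F = - (2 * of_real pi * \<i> * (\<Sum>k\<le>N. residue F (of_real (c + real k))))"
proof -
  \<comment> \<open>The right edge \<open>T + 1 / 2 = c + N + 1\<close> leaves room for the closing
    segment at abscissa \<open>T\<close> and makes \<open>c + N\<close> the last pole inside the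
    open strip.\<close>
  define S where "S = {s. - T < Re s \<and> Re s < T + 1 / 2}"
  define I where "I = {n :: int. - T < c + of_int n \<and> c + of_int n < T + 1 / 2}"
  define f :: "int \<Rightarrow> complex" where "f = (\<lambda>n. of_real (c + of_int n))"
  have S: "open S" "convex S"
  proof -
    have "S = {s. - T < Re s} \<inter> {s. Re s < T + 1 / 2}" by (auto simp: S_def)
    then show "open S" "convex S"
      by (auto intro!: open_Int convex_Int open_halfspace_Re_gt open_halfspace_Re_lt
               convex_halfspace_Re_gt convex_halfspace_Re_lt)
  qed
  have "I \<subseteq> {\<lfloor>- T - c\<rfloor>..\<lceil>T + 1 / 2 - c\<rceil>}"
    unfolding I_def by (auto; linarith)
  then have fin: "finite I" using finite_subset by blast
  have pts: "S - f ` I = S - shifted_Ints c"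
    by (auto simp: S_def I_def f_def shifted_Ints_altdef)
  have "contour_integral \<gamma> F =
      2 * pi * \<i> * (\<Sum>p\<in>f ` I. winding_number \<gamma> p * residue F p)"
  proof (rule Residue_theorem)
    show "F holomorphic_on S - f ` I"
      unfolding pts by (intro holomorphic_on_subset[OF holomorphic_integrand]) auto
    show "path_image \<gamma> \<subseteq> S - f ` I"
      unfolding pts using image by (simp add: S_def)
    show "\<forall>z. z \<notin> S \<longrightarrow> winding_number \<gamma> z = 0"
      using image assms(2,3) S(2)
      by (intro allI impI winding_number_zero_outside[of _ S]) (auto simp: S_def valid_path_imp_path)
  qed (use S fin assms in \<open>auto simp: convex_connected\<close>)
  also have "(\<Sum>p\<in>f ` I. winding_number \<gamma> p * residue F p) =
      (\<Sum>n\<in>I. winding_number \<gamma> (f n) * residue F (f n))"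
    by (subst sum.reindex) (auto simp: inj_on_def f_def)
  \<comment> \<open>Negative indices have winding number 0; the indices that remain run from 0 to
    \<open>N\<close>.\<close>
  also have "\<dots> = (\<Sum>n\<in>int ` {..N}. - residue F (f n))"
  proof (rule sum.mono_neutral_cong_right)
    show "int ` {..N} \<subseteq> I" using c by (auto simp: I_def T_def)
    show "\<forall>n\<in>I - int ` {..N}. winding_number \<gamma> (f n) * residue F (f n) = 0"
    proof
      fix n assume n: "n \<in> I - int ` {..N}"
      then have "of_int n < real N + 1" by (auto simp: I_def T_def)
      then have "n \<le> int N" by linarith
      then have "n < 0" using n by (metis DiffD2 atMost_iff image_eqI linorder_not_less nat_0_le of_nat_le_iff)
      then have "f n = of_real (c - 1 - real (nat (- n - 1)))"
        by (simp add: f_def)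
      moreover have "winding_number \<gamma> (of_real (c - 1 - real (nat (- n - 1)))) = 0"
        using n \<open>n < 0\<close> by (intro winding_a) (auto simp: I_def)
      ultimately show "winding_number \<gamma> (f n) * residue F (f n) = 0" by simp
    qed
    show "winding_number \<gamma> (f n) * residue F (f n) = - residue F (f n)" if "n \<in> int ` {..N}" for n
      using that winding_b by (auto simp: f_def)
  qed (use fin in auto)
  also have "\<dots> = (\<Sum>k\<le>N. - residue F (of_real (c + real k)))"
    by (subst sum.reindex) (auto simp: f_def)
  finally show ?thesis by (simp add: sum_negf)
qed

text \<open>For large \<open>N\<close> the cut contour and its closing segment form a closed path
  inside the strip, and admissibility supplies the winding numbers.\<close>

lemma contour_integral_eq_residues:
  assumes adm: "mb_admissible Right_Loop 1 1 as bs g"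
  defines "T \<equiv> \<lambda>N::nat. c + 1 / 2 + real N"
  shows "\<forall>\<^sub>F N in sequentially.
    contour_integral (mb_contour Right_Loop g (T N)) F + contour_integral (mb_closing Right_Loop g (T N)) F =
    - (2 * of_real pi * \<i> * (\<Sum>k\<le>N. residue F (of_real (c + real k))))"
proof -
  have g: "valid_path g" using adm by (simp add: mb_admissible_def)
  \<comment> \<open>A finite path is bounded, so \<open>g\<close> lies inside the strip as soon as
    \<open>T N\<close> is at least \<open>R\<close>.\<close>
  obtain R where R: "\<And>s. s \<in> path_image g \<Longrightarrow> norm s < R"
    using bounded_path_image[OF valid_path_imp_path[OF g]] bounded_pos_less by metis
  have T: "filterlim T at_top sequentially"
    unfolding T_def by (intro filterlim_tendsto_add_at_top[OF tendsto_const] filterlim_real_sequentially)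
  have "\<forall>\<^sub>F x in at_top. R \<le> x \<and>
        path_image (mb_contour Right_Loop g x) \<inter> (meijer_poles_b 1 bs \<union> meijer_poles_a 1 as) = {} \<and>
        (\<forall>w\<in>meijer_poles_b 1 bs. cmod w < x \<longrightarrow>
           winding_number (mb_contour Right_Loop g x +++ mb_closing Right_Loop g x) w = - 1) \<and>
        (\<forall>w\<in>meijer_poles_a 1 as. cmod w < x \<longrightarrow>
           winding_number (mb_contour Right_Loop g x +++ mb_closing Right_Loop g x) w = 0)"
    using adm by (auto simp: mb_admissible_def eventually_conj_iff eventually_ge_at_top)
  from eventually_compose_filterlim[OF this T] show ?thesis
  proof eventually_elim
    case (elim N)
    define G H where "G = mb_contour Right_Loop g (T N)" and "H = mb_closing Right_Loop g (T N)"
    have avoid: "path_image G \<inter> shifted_Ints c = {}"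
      using elim unfolding poles G_def by blast
    have wb: "winding_number (G +++ H) w = - 1" if "w \<in> meijer_poles_b 1 bs" "norm w < T N" for w
      using that elim unfolding G_def H_def by blast
    have wa: "winding_number (G +++ H) w = 0" if "w \<in> meijer_poles_a 1 as" "norm w < T N" for w
      using that elim unfolding G_def H_def by blast
    have valid: "valid_path G" "valid_path H" "pathfinish G = pathstart H" "pathfinish H = pathstart G"
      using g by (auto simp: G_def H_def mb_contour_def mb_closing_def intro!: valid_path_join)
    define S where "S = {s. - T N < Re s \<and> Re s < T N + 1 / 2}"
    have "S = {s. - T N < Re s} \<inter> {s. Re s < T N + 1 / 2}" by (auto simp: S_def)
    then have "convex S"
      by (auto intro!: convex_Int convex_halfspace_Re_gt convex_halfspace_Re_lt)
    have gS: "path_image g \<subseteq> S"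
    proof
      fix s assume "s \<in> path_image g"
      then have "\<bar>Re s\<bar> < T N" using R[of s] elim abs_Re_le_cmod[of s] by linarith
      then show "s \<in> S" by (auto simp: S_def)
    qed
    have "0 < T N" using c by (simp add: T_def)
    then have ends: "mb_start Right_Loop g (T N) \<in> S" "mb_finish Right_Loop g (T N) \<in> S"
      "pathstart g \<in> S" "pathfinish g \<in> S"
      using gS by (auto simp: S_def)
    have avoidH: "path_image H \<inter> shifted_Ints c = {}"
      using half_integer_shift_not_shifted_Ints[of _ c N]
      by (auto simp: H_def mb_closing_def closed_segment_same_Re T_def)
    have "path_image (G +++ H) =
        closed_segment (mb_start Right_Loop g (T N)) (pathstart g) \<union> path_image g \<union>
        closed_segment (pathfinish g) (mb_finish Right_Loop g (T N)) \<union>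
        closed_segment (mb_finish Right_Loop g (T N)) (mb_start Right_Loop g (T N))"
      using valid(3) by (simp add: G_def H_def mb_contour_def mb_closing_def path_image_join Un_assoc)
    also have "\<dots> \<subseteq> S"
      using ends gS \<open>convex S\<close> by (intro Un_least closed_segment_subset)
    finally have "path_image (G +++ H) \<subseteq> S" .
    then have image: "path_image (G +++ H) \<subseteq> S - shifted_Ints c"
      using avoid avoidH valid(3) by (auto simp: path_image_join)
    have "contour_integral (G +++ H) F =
        - (2 * of_real pi * \<i> * (\<Sum>k\<le>N. residue F (of_real (c + real k))))"
    proof (rule contour_integral_closed)
      \<comment> \<open>For \<open>k \<le> N\<close> the modulus \<open>c + k\<close> is less than
        \<open>T N = c + 1 / 2 + N\<close>, the range where admissibility speaks; a left pole has
        modulus \<open>k + 1 - c\<close>.\<close>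
      show "winding_number (G +++ H) (of_real (c + real k)) = - 1" if "k \<le> N" for k
        using that c by (intro wb) (simp_all only: poles_b rangeI norm_of_real T_def, simp)
      show "winding_number (G +++ H) (of_real (c - 1 - real k)) = 0"
        if "real k + 1 - c < c + 1 / 2 + real N" for k
        using that c by (intro wa) (simp_all only: poles_a rangeI norm_of_real T_def, simp)
    qed (use valid image in \<open>auto simp: S_def T_def\<close>)
    moreover have "contour_integral (G +++ H) F = contour_integral G F + contour_integral H F"
      using valid avoid avoidH by (intro contour_integral_join contour_integrable)
    ultimately show ?case by (simp add: G_def H_def)
  qed
qed

text \<open>The closing segments are integer translates of one segment of fixed length, along which
  the integrand tends to 0 uniformly.\<close>

lemma contour_integral_closing_tendsto_0:
  "(\<lambda>N. contour_integral (mb_closing Right_Loop g (c + 1 / 2 + real (Suc N))) F) \<longlonglongrightarrow> 0"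
proof -
  define y1 y2 where "y1 = Im (pathstart g)" and "y2 = Im (pathfinish g)"
  \<comment> \<open>The family starts at \<open>c + 3 / 2\<close>, not at \<open>c + 1 / 2\<close>,
    because \<open>tail_bound\<close> needs abscissas of at least 1.\<close>
  define K where "K = closed_segment (Complex (c + 3 / 2) y2) (Complex (c + 3 / 2) y1)"
  have K: "K = {s. Re s = c + 3 / 2 \<and> Im s \<in> closed_segment y2 y1}"
    by (simp add: K_def closed_segment_same_Re)
  have "1 \<le> Re s \<and> s \<notin> shifted_Ints c" if "s \<in> K" for s
    using that c half_integer_shift_not_shifted_Ints[of s c 1] by (auto simp: K)
  then obtain e where e: "e \<longlonglongrightarrow> 0" "\<And>n. 0 \<le> e n" "\<And>s n. s \<in> K \<Longrightarrow> norm (F (s + of_nat n)) \<le> e n"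
    using tail_bound[of K] by (auto simp: K_def)
  have bound: "norm (contour_integral (mb_closing Right_Loop g (c + 1 / 2 + real (Suc N))) F) \<le> e N * \<bar>y1 - y2\<bar>" for N
  proof -
    define x where "x = c + 3 / 2 + real N"
    have seg: "closed_segment (Complex x y2) (Complex x y1) = {s. Re s = x \<and> Im s \<in> closed_segment y2 y1}"
      by (simp add: closed_segment_same_Re)
    have "norm (contour_integral (linepath (Complex x y2) (Complex x y1)) F)
        \<le> e N * norm (Complex x y1 - Complex x y2)"
    proof (rule contour_integral_bound_linepath)
      show "F contour_integrable_on linepath (Complex x y2) (Complex x y1)"
      proof (intro contour_integrable)
        have "s \<notin> shifted_Ints c" if "Re s = x" for s
          using that half_integer_shift_not_shifted_Ints[of s c "Suc N"] by (simp add: x_def)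
        then show "path_image (linepath (Complex x y2) (Complex x y1)) \<inter> shifted_Ints c = {}"
          by (auto simp: seg)
      qed simp
      show "norm (F s) \<le> e N" if "s \<in> closed_segment (Complex x y2) (Complex x y1)" for s
      proof -
        have "s - of_nat N \<in> K" using that unfolding K seg by (simp add: x_def)
        then show ?thesis using e(3)[of "s - of_nat N" N] by (simp del: One_nat_def)
      qed
    qed (use e in auto)
    moreover have "norm (Complex x y1 - Complex x y2) = \<bar>y1 - y2\<bar>"
      by (simp add: cmod_def)
    ultimately show ?thesis
      by (simp add: mb_closing_def y1_def y2_def x_def add_ac)
  qed
  show ?thesis
    by (rule Lim_null_comparison[OF always_eventually[OF allI[OF bound]] tendsto_mult_left_zero[OF e(1)]])
qed

text \<open>The closing term vanishes in the limit, so the residues alone decide it, whatever the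
  admissible \<open>g\<close>. Existence and uniqueness of the G-value both rest on this.\<close>

lemma contour_integral_tendsto_residue_sum:
  assumes adm: "mb_admissible Right_Loop 1 1 as bs g"
    and sums: "(\<lambda>k. - residue F (of_real (c + real k))) sums w"
  shows "(\<lambda>N. contour_integral (mb_contour Right_Loop g (c + 1 / 2 + real (Suc N))) F / (2 * of_real pi * \<i>))
    \<longlonglongrightarrow> w"
proof -
  let ?T = "\<lambda>N. c + 1 / 2 + real (Suc N)"
  have "(\<lambda>N. \<Sum>k\<le>Suc N. - residue F (of_real (c + real k))) \<longlonglongrightarrow> w"
    using sums LIMSEQ_Suc[of "\<lambda>N. \<Sum>k\<le>N. - residue F (of_real (c + real k))"]
    by (simp add: sums_def_le)
  then have "(\<lambda>N. (\<Sum>k\<le>Suc N. - residue F (of_real (c + real k))) -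
      contour_integral (mb_closing Right_Loop g (?T N)) F / (2 * of_real pi * \<i>)) \<longlonglongrightarrow> w - 0 / (2 * of_real pi * \<i>)"
    by (intro tendsto_diff tendsto_divide contour_integral_closing_tendsto_0 tendsto_const) auto
  moreover have "\<forall>\<^sub>F N in sequentially. (\<Sum>k\<le>Suc N. - residue F (of_real (c + real k))) -
      contour_integral (mb_closing Right_Loop g (?T N)) F / (2 * of_real pi * \<i>) =
      contour_integral (mb_contour Right_Loop g (?T N)) F / (2 * of_real pi * \<i>)"
    using contour_integral_eq_residues[OF adm, THEN sequentially_offset, of 1]
  proof eventually_elim
    case (elim N)
    then have "contour_integral (mb_contour Right_Loop g (?T N)) F =
        2 * of_real pi * \<i> * (\<Sum>k\<le>Suc N. - residue F (of_real (c + real k))) -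
        contour_integral (mb_closing Right_Loop g (?T N)) F"
      unfolding sum_negf by (simp add: algebra_simps del: sum.atMost_Suc)
    then show ?case by (simp add: diff_divide_distrib del: sum.atMost_Suc)
  qed
  ultimately have "(\<lambda>N. contour_integral (mb_contour Right_Loop g (?T N)) F / (2 * of_real pi * \<i>))
      \<longlonglongrightarrow> w - 0 / (2 * of_real pi * \<i>)"
    by (rule Lim_transform_eventually)
  then show ?thesis by simp
qed

section \<open>The rectangular loop: admissibility and convergence\<close>

text \<open>The loop crosses the real axis at 0, which separates the two families because
  \<open>c - 1 < 0 < c\<close>. Closed up, it is the boundary of a rectangle run through
  clockwise.\<close>

lemma rectangle_admissible: "mb_admissible Right_Loop 1 1 as bs (linepath (- \<i>) \<i>)"
proof -
  have "path_image (mb_contour Right_Loop (linepath (- \<i>) \<i>) T) \<inter> shifted_Ints c = {} \<and>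
      (\<forall>w\<in>meijer_poles_b 1 bs. cmod w < T \<longrightarrow>
        winding_number (mb_contour Right_Loop (linepath (- \<i>) \<i>) T +++
          mb_closing Right_Loop (linepath (- \<i>) \<i>) T) w = - 1) \<and>
      (\<forall>w\<in>meijer_poles_a 1 as. cmod w < T \<longrightarrow>
        winding_number (mb_contour Right_Loop (linepath (- \<i>) \<i>) T +++
          mb_closing Right_Loop (linepath (- \<i>) \<i>) T) w = 0)" if T: "T > 0" for T
  proof -
    define p q where "p = Complex T (- 1)" and "q = Complex T 1"
    define G H where "G = mb_contour Right_Loop (linepath (- \<i>) \<i>) T"
      and "H = mb_closing Right_Loop (linepath (- \<i>) \<i>) T"
    have G: "G = linepath p (- \<i>) +++ linepath (- \<i>) \<i> +++ linepath \<i> q" and H: "H = linepath q p"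
      by (simp_all add: G_def H_def mb_contour_def mb_closing_def p_def q_def)
    \<comment> \<open>\<open>rectpath\<close> has the opposite orientation and another starting
      point; the four sides are the same up to reversal.\<close>
    have R: "rectpath (- \<i>) q = linepath (- \<i>) p +++ linepath p q +++ linepath q \<i> +++ linepath \<i> (- \<i>)"
    proof -
      have "Complex (Re q) (Im (- \<i>)) = p" "Complex (Re (- \<i>)) (Im q) = \<i>"
        by (simp_all add: p_def q_def complex_eq_iff)
      then show ?thesis by (simp only: rectpath_def Let_def)
    qed
    have seg: "closed_segment p (- \<i>) = {s. Im s = - 1 \<and> Re s \<in> closed_segment T 0}"
      "closed_segment (- \<i>) \<i> = {s. Re s = 0 \<and> Im s \<in> closed_segment (- 1) 1}"
      "closed_segment \<i> q = {s. Im s = 1 \<and> Re s \<in> closed_segment 0 T}"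
      "closed_segment q p = {s. Re s = T \<and> Im s \<in> closed_segment 1 (- 1)}"
      by (simp_all add: p_def q_def closed_segment_same_Im closed_segment_same_Re)
    \<comment> \<open>No integer \<open>n\<close> satisfies \<open>c + n = 0\<close>, since it would
      lie strictly between -1 and 0.\<close>
    have pole: "Im w = 0 \<and> Re w \<noteq> 0" if w: "w \<in> shifted_Ints c" for w
    proof -
      obtain n :: int where n: "w = of_real (c + of_int n)"
        using w unfolding shifted_Ints_altdef by blast
      have "c + of_int n \<noteq> 0"
      proof
        assume "c + of_int n = 0"
        then have "real_of_int n < 0" "- 1 < real_of_int n" using c by linarith+
        then have "n < 0" "- 1 < n" by linarith+
        then show False by linarith
      qed
      then show ?thesis by (simp add: n)
    qed
    have avoid: "path_image G \<inter> shifted_Ints c = {}"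
      using pole by (fastforce simp: G path_image_join seg)
    have winding: "winding_number (G +++ H) w = - winding_number (rectpath (- \<i>) q) w"
      if "w \<in> shifted_Ints c" "norm w < T" for w
    proof -
      have "\<bar>Re w\<bar> < T" using that(2) abs_Re_le_cmod[of w] by linarith
      then have not_seg: "w \<notin> closed_segment p (- \<i>)" "w \<notin> closed_segment (- \<i>) \<i>"
        "w \<notin> closed_segment \<i> q" "w \<notin> closed_segment q p"
        using pole[OF that(1)] by (auto simp: seg)
      have rev: "winding_number (linepath v u) w = - winding_number (linepath u v) w"
        if "w \<notin> closed_segment u v" for u v
        using winding_number_reversepath[of "linepath u v" w] that by simp
      have not_seg': "w \<notin> closed_segment (- \<i>) p" "w \<notin> closed_segment \<i> (- \<i>)"
        "w \<notin> closed_segment q \<i>" "w \<notin> closed_segment p q"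
        using not_seg by (simp_all add: closed_segment_commute)
      \<comment> \<open>Winding numbers add over the sides, so the starting point is irrelevant and
        each reversed side changes sign.\<close>
      show ?thesis
        using not_seg not_seg' unfolding R G H
        by (simp add: winding_number_join path_image_join
              rev[of p "- \<i>"] rev[of "- \<i>" \<i>] rev[of \<i> q] rev[of q p])
    qed
    have "winding_number (G +++ H) w = - 1" if w: "w \<in> meijer_poles_b 1 bs" "norm w < T" for w
    proof -
      obtain k where k: "w = of_real (c + real k)" using w(1) unfolding poles_b by auto
      have "c + real k < T" using w(2) c unfolding k norm_of_real by linarith
      then have "w \<in> box (- \<i>) q" using c by (simp add: in_box_complex_iff k q_def)
      then have "winding_number (rectpath (- \<i>) q) w = 1" by (rule winding_number_rectpath)
      then show ?thesis using winding[of w] w poles by auto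
    qed
    moreover have "winding_number (G +++ H) w = 0" if w: "w \<in> meijer_poles_a 1 as" "norm w < T" for w
    proof -
      obtain k where k: "w = of_real (c - 1 - real k)" using w(1) unfolding poles_a by auto
      then have "w \<notin> cbox (- \<i>) q" using c by (simp add: in_cbox_complex_iff q_def)
      then have "winding_number (rectpath (- \<i>) q) w = 0"
        using T by (intro winding_number_rectpath_outside) (auto simp: q_def)
      then show ?thesis using winding[of w] w poles by auto
    qed
    ultimately show ?thesis using avoid by (simp add: G_def H_def)
  qed
  then show ?thesis
    unfolding mb_admissible_def poles
    by (intro conjI valid_path_linepath eventually_mono[OF eventually_gt_at_top[of 0]]) simp_all
qed

text \<open>The previous limit runs through the abscissas \<open>c + 3/2 + N\<close> only; between two of them the
  contour integral changes by two segments of length at most 1 on the rays.\<close>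

lemma contour_integral_rectangle_tendsto:
  assumes sums: "(\<lambda>k. - residue F (of_real (c + real k))) sums w"
  shows "((\<lambda>T. contour_integral (mb_contour Right_Loop (linepath (- \<i>) \<i>) T) F / (2 * of_real pi * \<i>))
    \<longlongrightarrow> w) at_top"
proof -
  define J where "J y u v = contour_integral (linepath (Complex u y) (Complex v y)) F" for y u v
  define G where "G = (\<lambda>T. contour_integral (mb_contour Right_Loop (linepath (- \<i>) \<i>) T) F)"
  define d where "d = c + 3 / 2"
  \<comment> \<open>For \<open>T \<ge> d\<close> this gives
    \<open>d + n T \<le> T < d + n T + 1\<close>, so \<open>d + n T\<close> is the last abscissa of
    the known sequence before \<open>T\<close>.\<close>
  define n where "n = (\<lambda>T. nat \<lfloor>T - d\<rfloor>)"
  have i: "\<i> = Complex 0 1" "- \<i> = Complex 0 (- 1)" by (simp_all add: complex_eq_iff)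
  have seg: "closed_segment (Complex u y) (Complex v y) = {s. Im s = y \<and> Re s \<in> closed_segment u v}" for u v y
    by (simp add: closed_segment_same_Im)
  have off: "s \<notin> shifted_Ints c" if "Im s \<noteq> 0" for s
    using that by (auto simp: shifted_Ints_altdef)
  have cont: "continuous_on (closed_segment (Complex u y) (Complex v y)) F" if "y \<noteq> 0" for u v y
    using that off by (intro continuous_on_subset[OF continuous_on_integrand]) (auto simp: seg)
  have G_eq: "G T = J (- 1) T 0 + contour_integral (linepath (- \<i>) \<i>) F + J 1 0 T" for T
  proof -
    have "F contour_integrable_on linepath (Complex T (- 1)) (- \<i>)"
      "F contour_integrable_on linepath \<i> (Complex T 1)"
      unfolding i(2) unfolding i(1) by (intro contour_integrable_continuous_linepath cont; simp)+
    moreover have "F contour_integrable_on linepath (- \<i>) \<i>"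
    proof (intro contour_integrable)
      have "path_image (linepath (- \<i>) \<i>) \<subseteq> path_image (mb_contour Right_Loop (linepath (- \<i>) \<i>) T)" for T
        by (auto simp: mb_contour_def path_image_join)
      moreover have "\<forall>\<^sub>F T in at_top.
          path_image (mb_contour Right_Loop (linepath (- \<i>) \<i>) T) \<inter> shifted_Ints c = {}"
        using rectangle_admissible unfolding mb_admissible_def poles
        by (blast intro: eventually_mono)
      then obtain T where "path_image (mb_contour Right_Loop (linepath (- \<i>) \<i>) T) \<inter> shifted_Ints c = {}"
        using eventually_happens'[OF trivial_limit_at_top_linorder] by blast
      ultimately show "path_image (linepath (- \<i>) \<i>) \<inter> shifted_Ints c = {}" by blast
    qed simp
    ultimately show ?thesis
      unfolding G_def J_def i(1)[symmetric] i(2)[symmetric]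
      by (simp add: mb_contour_def contour_integrable_joinI)
  qed
  have J_split: "J y u v = J y u t + J y t v" if "y \<noteq> 0" "t \<in> closed_segment u v" for y u v t
    unfolding J_def using that by (intro contour_integral_split_linepath cont) (auto simp: seg)
  \<comment> \<open>Off the real axis there are no poles, so all these pieces lie in translates of
    one unit segment. Both directions are needed: the lower ray runs inwards, the upper one
    outwards.\<close>
  have tail: "\<exists>e. e \<longlonglongrightarrow> 0 \<and> (\<forall>T\<ge>d. norm (J y (d + real (n T)) T) \<le> e (n T) \<and> norm (J y T (d + real (n T))) \<le> e (n T))"
    if y: "y \<noteq> 0" for y
  proof -
    define K where "K = closed_segment (Complex d y) (Complex (d + 1) y)"
    have K: "K = {s. Im s = y \<and> d \<le> Re s \<and> Re s \<le> d + 1}"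
      by (auto simp: K_def seg closed_segment_eq_real_ivl)
    have "1 \<le> Re s \<and> s \<notin> shifted_Ints c" if "s \<in> K" for s
      using that y c off[of s] by (auto simp: K d_def)
    then obtain e where e: "e \<longlonglongrightarrow> 0" "\<And>n. 0 \<le> e n" "\<And>s n. s \<in> K \<Longrightarrow> norm (F (s + of_nat n)) \<le> e n"
      using tail_bound[of K] by (auto simp: K_def)
    have bound: "norm (J y u v) \<le> e m"
      if "u \<in> {d + real m..d + real m + 1}" "v \<in> {d + real m..d + real m + 1}" for u v m
    proof -
      have "norm (J y u v) \<le> e m * norm (Complex v y - Complex u y)"
        unfolding J_def
      proof (rule contour_integral_bound_linepath)
        show "norm (F s) \<le> e m" if "s \<in> closed_segment (Complex u y) (Complex v y)" for s
        proof -
          have "s - of_nat m \<in> K"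
            using that \<open>u \<in> _\<close> \<open>v \<in> _\<close> unfolding K seg
            by (auto simp: closed_segment_eq_real_ivl split: if_splits)
          then show ?thesis using e(3)[of "s - of_nat m" m] by (simp del: One_nat_def)
        qed
        show "F contour_integrable_on linepath (Complex u y) (Complex v y)"
          using y by (intro contour_integrable_continuous_linepath cont)
      qed (rule e(2))
      also have "norm (Complex v y - Complex u y) = \<bar>v - u\<bar>" by (simp add: cmod_def)
      also have "e m * \<bar>v - u\<bar> \<le> e m * 1"
        using that e(2) by (intro mult_left_mono) auto
      finally show ?thesis by simp
    qed
    have "T \<in> {d + real (n T)..d + real (n T) + 1}" if "T \<ge> d" for T
      using that by (simp add: n_def) linarith
    then show ?thesis using e(1) bound by (intro exI[of _ e]) auto
  qed
  obtain e1 where e1: "e1 \<longlonglongrightarrow> 0" "\<And>T. T \<ge> d \<Longrightarrow> norm (J (- 1) T (d + real (n T))) \<le> e1 (n T)"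
    using tail[of "- 1"] by auto
  obtain e2 where e2: "e2 \<longlonglongrightarrow> 0" "\<And>T. T \<ge> d \<Longrightarrow> norm (J 1 (d + real (n T)) T) \<le> e2 (n T)"
    using tail[of 1] by auto
  have n: "filterlim n sequentially at_top"
    unfolding n_def
    by (intro filterlim_compose[OF filterlim_nat_sequentially] filterlim_compose[OF filterlim_floor_sequentially]
        filterlim_tendsto_add_at_top[of "\<lambda>_. - d" "- d", simplified] filterlim_ident tendsto_const)
  \<comment> \<open>The vertical side and the inner parts of the rays cancel; only the two outer
    pieces remain.\<close>
  have diff: "norm (G T - G (d + real (n T))) \<le> e1 (n T) + e2 (n T)" if T: "T \<ge> d" for T
  proof -
    have "0 \<le> d" using c by (simp add: d_def)
    moreover have "d + real (n T) \<le> T" using T by (simp add: n_def) linarith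
    ultimately have "d + real (n T) \<in> closed_segment 0 T" "d + real (n T) \<in> closed_segment T 0"
      using T by (auto simp: closed_segment_eq_real_ivl)
    then have "G T - G (d + real (n T)) = J (- 1) T (d + real (n T)) + J 1 (d + real (n T)) T"
      using J_split[of "- 1" "d + real (n T)" T 0] J_split[of 1 "d + real (n T)" 0 T] by (simp add: G_eq)
    then show ?thesis
      using e1(2)[OF T] e2(2)[OF T] by (metis add_mono norm_triangle_le)
  qed
  have "((\<lambda>T. e1 (n T) + e2 (n T)) \<longlongrightarrow> 0 + 0) at_top"
    by (intro tendsto_add filterlim_compose[OF e1(1) n] filterlim_compose[OF e2(1) n])
  then have "((\<lambda>T. e1 (n T) + e2 (n T)) \<longlongrightarrow> 0) at_top" by simp
  then have "((\<lambda>T. G T - G (d + real (n T))) \<longlongrightarrow> 0) at_top"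
    by (rule Lim_null_comparison[rotated]) (auto intro: eventually_mono[OF eventually_ge_at_top[of d]] diff)
  moreover have "((\<lambda>T. G (d + real (n T)) / (2 * of_real pi * \<i>)) \<longlongrightarrow> w) at_top"
    using filterlim_compose[OF contour_integral_tendsto_residue_sum[OF rectangle_admissible sums] n]
    by (simp add: G_def d_def add_ac)
  ultimately have "((\<lambda>T. (G T - G (d + real (n T))) / (2 * of_real pi * \<i>) + G (d + real (n T)) / (2 * of_real pi * \<i>))
      \<longlongrightarrow> 0 / (2 * of_real pi * \<i>) + w) at_top"
    by (intro tendsto_add tendsto_divide tendsto_const) auto
  then show ?thesis by (simp add: G_def diff_divide_distrib)
qed

section \<open>Residues and the value of the G-function\<close>

text \<open>At \<open>c + k\<close> only \<open>Gamma (c - s)\<close> is singular. Its residue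
  contributes \<open>1 / fact k\<close>, which the value \<open>fact k\<close> of the other Gamma
  factor cancels.\<close>

lemma residue_meijer_integrand:
  "residue F (of_real (c + real k)) =
    - ((-1) ^ k * (\<Prod>j=1..<length bs. rGamma (1 - bs ! j + of_real (c + real k))) *
       (\<Prod>j=1..<length as. rGamma (as ! j - of_real (c + real k))) * z powr of_real (c + real k))"
proof -
  define p :: complex where "p = of_real (c + real k)"
  define h where "h s = Gamma (1 - of_real c + s) * (\<Prod>j=1..<length bs. rGamma (1 - bs ! j + s)) *
     (\<Prod>j=1..<length as. rGamma (as ! j - s)) * z powr s" for s
  have F_eq: "F s = Gamma (of_real c - s) * h s" for s
    by (simp add: meijer_integrand_def h_def params mult.assoc)
  have "h holomorphic_on {s. 0 < Re s}"
  proof -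
    have "1 - of_real c + s \<notin> \<int>\<^sub>\<le>\<^sub>0" if "0 < Re s" for s :: complex
      using that c by (auto elim!: nonpos_Ints_cases simp: complex_eq_iff)
    then show ?thesis
      unfolding h_def[abs_def] using z by (auto intro!: holomorphic_intros)
  qed
  then have "isCont h p"
    using c by (auto simp: p_def open_halfspace_Re_gt continuous_on_eq_continuous_at
        dest!: holomorphic_on_imp_continuous_on)
  then have h: "h \<midarrow>p\<rightarrow> h p" by (simp add: isCont_def)
  have "filterlim (\<lambda>s. of_real c - s) (at (- of_nat k)) (at p)"
  proof (rule filterlim_atI)
    show "(\<lambda>s. of_real c - s) \<midarrow>p\<rightarrow> - of_nat k"
      by (auto intro!: tendsto_eq_intros simp: p_def)
    show "\<forall>\<^sub>F s in at p. of_real c - s \<noteq> - of_nat k"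
      using eventually_neq_at_within[of p] by eventually_elim (auto simp: p_def algebra_simps)
  qed
  then have "((\<lambda>s. Gamma (of_real c - s) * (of_real c - s + of_nat k)) \<longlongrightarrow> (-1) ^ k / fact k) (at p)"
    by (rule filterlim_compose[OF Gamma_residues])
  then have "((\<lambda>s. - (Gamma (of_real c - s) * (of_real c - s + of_nat k)) * h s) \<longlongrightarrow>
      - ((-1) ^ k / fact k) * h p) (at p)"
    by (intro tendsto_intros h)
  \<comment> \<open>The argument \<open>c - s\<close> decreases in \<open>s\<close>, which is the
    origin of the minus sign.\<close>
  moreover have "- (Gamma (of_real c - s) * (of_real c - s + of_nat k)) * h s = F s * (s - p)" for s
    unfolding F_eq by (simp add: p_def algebra_simps)
  ultimately have lim: "(\<lambda>s. F s * (s - p)) \<midarrow>p\<rightarrow> - ((-1) ^ k / fact k) * h p"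
    by simp
  \<comment> \<open>Neighbouring poles have distance 1, so the unit disc isolates
    \<open>p\<close>.\<close>
  have "ball p 1 - {p} \<subseteq> - shifted_Ints c"
  proof
    fix s assume s: "s \<in> ball p 1 - {p}"
    show "s \<in> - shifted_Ints c"
    proof
      assume "s \<in> shifted_Ints c"
      then obtain n :: int where n: "s = of_real (c + of_int n)"
        unfolding shifted_Ints_altdef by blast
      have "norm (p - s) < 1" using s by (simp add: dist_norm)
      also have "p - s = of_real (real k - of_int n)" by (simp add: n p_def)
      finally have "\<bar>real k - of_int n\<bar> < 1" by (simp only: norm_of_real)
      then have "n = int k" by linarith
      then have "s = p" by (simp add: n p_def)
      then show False using s by simp
    qed
  qed
  then have "residue F p = - ((-1) ^ k / fact k) * h p"
    by (intro residue_simple'[OF _ _ holomorphic_on_subset[OF holomorphic_integrand] lim]) auto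
  moreover have "Gamma (1 - of_real c + p) = fact k"
    by (simp add: p_def Gamma_fact)
  ultimately show ?thesis
    by (simp add: h_def p_def mult.assoc)
qed

text \<open>The rectangle provides existence. For uniqueness the convergence conditions leave only
  right loops, and any limit along all \<open>T\<close> is also the limit along the abscissas midway
  between poles.\<close>

lemma meijer_G_eq_residue_series:
  assumes sums: "(\<lambda>k. - residue F (of_real (c + real k))) sums w"
  shows "meijer_G 1 1 as bs z = w"
  unfolding meijer_G_def
proof (rule the_equality)
  show "has_meijer_G 1 1 as bs z w"
    unfolding has_meijer_G_def
    using lengths z rectangle_admissible contour_integral_rectangle_tendsto[OF sums]
    by (intro conjI exI[of _ Right_Loop] exI[of _ "linepath (- \<i>) \<i>"]) (auto simp: Suc_le_eq)
next
  fix v assume "has_meijer_G 1 1 as bs z v"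
  then obtain K g where K: "mb_converges K 1 1 (length as) (length bs) z"
    and g: "mb_admissible K 1 1 as bs g"
    and lim: "((\<lambda>T. contour_integral (mb_contour K g T) F / (2 * of_real pi * \<i>)) \<longlongrightarrow> v) at_top"
    unfolding has_meijer_G_def by blast
  have "K = Right_Loop"
    using K lengths by (cases K) auto
  moreover have "filterlim (\<lambda>N. c + 1 / 2 + real (Suc N)) at_top sequentially"
    by (intro filterlim_tendsto_add_at_top[OF tendsto_const]
        filterlim_compose[OF filterlim_real_sequentially filterlim_Suc])
  ultimately show "v = w"
    using filterlim_compose[OF lim] contour_integral_tendsto_residue_sum[OF _ sums] g LIMSEQ_unique by blast
qed

end

section \<open>The two G-functions\<close>

text \<open>By reflection the product is \<pi> divided by a sine, which changes sign under a unit
  shift. Here the sign comes from the functional equation at \<open>u\<close> and at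
  \<open>- u\<close>.\<close>

lemma Gamma_pair_shift:
  fixes s :: complex
  assumes "s \<notin> shifted_Ints c"
  shows "Gamma (of_real c - (s + 1)) * Gamma (1 - of_real c + (s + 1)) =
    - (Gamma (of_real c - s) * Gamma (1 - of_real c + s))"
proof -
  define u where "u = of_real c - (s + 1)"
  have "u = - (1 + (s - of_real c))" by (simp add: u_def)
  then have "u \<notin> \<int>"
    using assms by (simp only: minus_in_Ints_iff add_in_Ints_iff_left[OF Ints_1] shifted_Ints_iff not_False_eq_True)
  then have u: "u \<notin> \<int>\<^sub>\<le>\<^sub>0" "- u \<notin> \<int>\<^sub>\<le>\<^sub>0"
    using nonpos_Ints_Int minus_in_Ints_iff by blast+
  have shift: "Gamma (u + 1) = u * Gamma u" "Gamma (- u + 1) = - u * Gamma (- u)"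
    by (rule Gamma_plus1[OF u(1)], rule Gamma_plus1[OF u(2)])
  have "of_real c - s = u + 1" "1 - of_real c + s = - u" "1 - of_real c + (s + 1) = - u + 1"
    by (simp_all add: u_def)
  then show ?thesis
    unfolding u_def[symmetric] by (simp only: shift) (simp only: mult_minus_left mult_minus_right mult_ac)
qed

lemma norm_add_of_real_ge:
  assumes "0 \<le> Re s" "0 \<le> x"
  shows "norm (s + of_real x) \<ge> Re s + x"
  using complex_Re_le_cmod[of "s + of_real x"] by simp

text \<open>One linear factor is bounded below by \<open>Re s\<close>, the other by 1. This gives
  \<open>shift_bound\<close> with \<open>C = norm z\<close>.\<close>

lemma shift_bound_from_quadratic:
  fixes s :: complex
  assumes eq: "(s + of_real x) * (s + of_real y) * A = z * B"
    and "1 \<le> Re s" "0 \<le> x" "0 \<le> y"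
  shows "norm A \<le> norm z / Re s * norm B"
proof -
  have "Re s * 1 * norm A \<le> norm (s + of_real x) * norm (s + of_real y) * norm A"
    using assms norm_add_of_real_ge[of s x] norm_add_of_real_ge[of s y]
    by (intro mult_mono) auto
  also have "\<dots> = norm z * norm B"
    using arg_cong[OF eq, of norm] by (simp add: norm_mult)
  finally show ?thesis using assms by (simp add: field_simps)
qed

lemma meijer_integrand_1_3:
  "meijer_integrand 1 1 [a] [b, b1, b2] z s =
    Gamma (b - s) * Gamma (1 - a + s) * (rGamma (1 - b1 + s) * rGamma (1 - b2 + s)) * z powr s"
  by (simp add: meijer_integrand_def prod.atLeast_Suc_lessThan mult.assoc)

lemma meijer_integrand_2_4:
  "meijer_integrand 1 1 [a, a1] [b, b1, b2, b3] z s =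
    Gamma (b - s) * Gamma (1 - a + s) * (rGamma (1 - b1 + s) * rGamma (1 - b2 + s) * rGamma (1 - b3 + s)) *
    rGamma (a1 - s) * z powr s"
  by (simp add: meijer_integrand_def prod.atLeast_Suc_lessThan mult.assoc)

section \<open>Residue series identified with Struve series\<close>

text \<open>The condition on \<open>csqrt\<close> places \<open>w\<close> in the half-plane of
  principal roots, where halving the logarithm of the square gives the logarithm back.\<close>

lemma powr_of_csqrt_eq:
  assumes "w \<noteq> 0" "csqrt (w ^ 2) = w"
  shows "(w ^ 2 / 4) powr (3 / 4 + of_nat k) = (w / 2) powr (1 / 2 + 1) * (w / 2) ^ (2 * k)"
proof -
  define z where "z = (w / 2) ^ 2"
  have z: "z \<noteq> 0" "w ^ 2 / 4 = z" using assms by (simp_all add: z_def power_divide)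
  have "csqrt z = w / 2"
    unfolding z_def using csqrt_principal[of "w ^ 2"] assms(2) by (intro csqrt_unique) auto
  then have half: "z powr (1 / 2) = w / 2" by (simp add: csqrt_conv_powr)
  have "w / 2 = exp (Ln z / 2)"
    using z half by (simp add: powr_def)
  then have "Ln (w / 2) = Ln (exp (Ln z / 2))" by simp
  \<comment> \<open>The imaginary part of \<open>Ln z / 2\<close> is at most \<pi>/2 in modulus,
    well inside the principal range.\<close>
  also have "\<dots> = Ln z / 2"
    using mpi_less_Im_Ln[OF z(1)] Im_Ln_le_pi[OF z(1)] by (intro Ln_exp) auto
  finally have "Ln z = 2 * Ln (w / 2)" by (simp only:) simp
  then have "(w / 2) powr (1 / 2 + 1) = z powr (3 / 4)"
    using assms(1) z(1) by (simp add: powr_def)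
  moreover have "z powr (3 / 4 + of_nat k) = z powr (3 / 4) * z ^ k"
    using z(1) by (simp add: powr_add)
  ultimately show ?thesis by (simp add: z z_def power_mult)
qed

text \<open>At \<open>s = 3 / 4 + k\<close> the lower parameters -1/4 and 1/4 yield the reciprocal
  Gamma values at \<open>k + 2\<close> and \<open>k + 3 / 2\<close>, so the series agree term by
  term.\<close>

lemma meijer_G_eq_struve_H:
  assumes w: "w \<noteq> 0" "csqrt (w ^ 2) = w"
  shows "meijer_G 1 1 [3 / 4] [3 / 4, - 1 / 4, 1 / 4] (w ^ 2 / 4) = struve_H (1 / 2) w"
proof -
  define z where "z = w ^ 2 / 4"
  have z: "z \<noteq> 0" using w by (simp add: z_def)
  interpret meijer_right_loop "[3 / 4]" "[3 / 4, - 1 / 4, 1 / 4]" z "3 / 4" "norm z"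
  proof
    fix s :: complex assume s: "1 \<le> Re s" "s \<notin> shifted_Ints (3 / 4)"
    define A B where "A = meijer_integrand 1 1 [3 / 4] [3 / 4, - 1 / 4, 1 / 4] z (s + 1)"
      and "B = meijer_integrand 1 1 [3 / 4] [3 / 4, - 1 / 4, 1 / 4] z s"
    \<comment> \<open>The two reciprocal Gamma factors of the integrand produce the quadratic
      divisor under the shift.\<close>
    have "rGamma (s + 5 / 4) = (s + 5 / 4) * rGamma (s + 9 / 4)"
      "rGamma (s + 3 / 4) = (s + 3 / 4) * rGamma (s + 7 / 4)"
      using rGamma_plus1[of "s + 5 / 4"] rGamma_plus1[of "s + 3 / 4"] by (simp_all add: add.assoc)
    then have "(s + of_real (5 / 4)) * (s + of_real (3 / 4)) * A = (- z) * B"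
      using Gamma_pair_shift[OF s(2)] z unfolding A_def B_def meijer_integrand_1_3
      by (simp add: powr_add add_ac)
    from shift_bound_from_quadratic[OF this s(1)] show "norm A \<le> norm z / Re s * norm B"
      by simp
  qed (use z in auto)
  have "(\<lambda>k. (w / 2) powr (1 / 2 + 1) * ((-1) ^ k * (w / 2) ^ (2 * k) *
      rGamma (of_nat k + 3 / 2) * rGamma (of_nat k + 1 / 2 + 3 / 2))) sums struve_H (1 / 2) w"
    unfolding struve_H_def using struve_H_half_series[OF w(1)]
    by (intro sums_mult summable_sums) (rule sums_summable)
  moreover have "(w / 2) powr (1 / 2 + 1) * ((-1) ^ k * (w / 2) ^ (2 * k) *
      rGamma (of_nat k + 3 / 2) * rGamma (of_nat k + 1 / 2 + 3 / 2)) =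
      - residue F (of_real (3 / 4 + real k))" for k
    unfolding residue_meijer_integrand
    using powr_of_csqrt_eq[OF w, of k]
    by (simp add: z_def prod.atLeast_Suc_lessThan add_ac)
  ultimately show ?thesis
    unfolding z_def[symmetric] by (intro meijer_G_eq_residue_series) simp
qed

text \<open>These are the factors of the two parameters 1/2 at the pole \<open>3 / 4 + k\<close>.
  Their arguments add up to 1, so reflection reduces the product to a sine at an odd multiple of
  \<pi>/4.\<close>

lemma rGamma_pair_eq:
  "rGamma (of_nat k + 5 / 4) * rGamma (- 1 / 4 - of_nat k :: complex) =
     - ((-1) ^ k / (of_real (sqrt 2) * of_real pi))"
proof -
  have "rGamma (of_nat k + 5 / 4) * rGamma (1 - (of_nat k + 5 / 4) :: complex) =
      sin (of_real pi * (of_nat k + 5 / 4)) / of_real pi"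
    by (rule rGamma_reflection_complex)
  also have "of_real pi * (of_nat k + 5 / 4) = complex_of_real (real (Suc k) * pi + pi / 4)"
    by (simp add: algebra_simps)
  also have "sin \<dots> = of_real (sin (real (Suc k) * pi + pi / 4))"
    by (simp only: sin_of_real)
  also have "sin (real (Suc k) * pi + pi / 4) = - ((-1) ^ k / sqrt 2)"
    unfolding sin_add sin_npi cos_npi sin_45 by (simp add: real_div_sqrt divide_simps)
  also have "1 - (of_nat k + 5 / 4) = (- 1 / 4 - of_nat k :: complex)" by simp
  finally show ?thesis by simp
qed

text \<open>Compared with the first G-function, the parameter 1/2 in both rows adds a constant and a
  sign that undoes the alternation, turning the series of \<open>struve_H\<close> into that of
  \<open>struve_L\<close>.\<close>

lemma meijer_G_eq_struve_L:
  assumes w: "w \<noteq> 0" "csqrt (w ^ 2) = w"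
  shows "meijer_G 1 1 [3 / 4, 1 / 2] [3 / 4, 1 / 2, - 1 / 4, 1 / 4] (w ^ 2 / 4) =
    - (struve_L (1 / 2) w / (of_real (sqrt 2) * of_real pi))"
proof -
  define z where "z = w ^ 2 / 4"
  have z: "z \<noteq> 0" using w by (simp add: z_def)
  interpret meijer_right_loop "[3 / 4, 1 / 2]" "[3 / 4, 1 / 2, - 1 / 4, 1 / 4]" z "3 / 4" "norm z"
  proof
    fix s :: complex assume s: "1 \<le> Re s" "s \<notin> shifted_Ints (3 / 4)"
    define A B where "A = meijer_integrand 1 1 [3 / 4, 1 / 2] [3 / 4, 1 / 2, - 1 / 4, 1 / 4] z (s + 1)"
      and "B = meijer_integrand 1 1 [3 / 4, 1 / 2] [3 / 4, 1 / 2, - 1 / 4, 1 / 4] z s"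
    have r: "rGamma (s + 5 / 4) = (s + 5 / 4) * rGamma (s + 9 / 4)"
      "rGamma (s + 3 / 4) = (s + 3 / 4) * rGamma (s + 7 / 4)"
      "rGamma (s + 1 / 2) = (s + 1 / 2) * rGamma (s + 3 / 2)"
      using rGamma_plus1[of "s + 5 / 4"] rGamma_plus1[of "s + 3 / 4"] rGamma_plus1[of "s + 1 / 2"]
      by (simp_all add: add.assoc)
    \<comment> \<open>The factor \<open>s + 1 / 2\<close> cancels against the third equation of
      \<open>r\<close>; the minus sign cancels that of \<open>Gamma_pair_shift\<close>.\<close>
    have r': "rGamma (1 / 2 - (s + 1)) = - ((s + 1 / 2) * rGamma (1 / 2 - s))"
      using rGamma_plus1[of "1 / 2 - (s + 1)"] by (simp add: algebra_simps)
    have "A = (Gamma (of_real (3 / 4) - (s + 1)) * Gamma (1 - of_real (3 / 4) + (s + 1))) *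
        (rGamma (s + 3 / 2) * rGamma (s + 9 / 4) * rGamma (s + 7 / 4)) * rGamma (1 / 2 - (s + 1)) * (z * z powr s)"
      using z unfolding A_def meijer_integrand_2_4 by (simp add: powr_add add_ac)
    moreover have "B = (Gamma (of_real (3 / 4) - s) * Gamma (1 - of_real (3 / 4) + s)) *
        (rGamma (s + 1 / 2) * rGamma (s + 5 / 4) * rGamma (s + 3 / 4)) * rGamma (1 / 2 - s) * z powr s"
      unfolding B_def meijer_integrand_2_4 by (simp add: add_ac)
    ultimately have "(s + of_real (5 / 4)) * (s + of_real (3 / 4)) * A = z * B"
      unfolding Gamma_pair_shift[OF s(2)] r r' by (simp add: mult_ac)
    from shift_bound_from_quadratic[OF this s(1)] show "norm A \<le> norm z / Re s * norm B"
      by simp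
  qed (use z in auto)
  have "(\<lambda>k. (w / 2) powr (1 / 2 + 1) * ((w / 2) ^ (2 * k) *
      rGamma (of_nat k + 3 / 2) * rGamma (of_nat k + 1 / 2 + 3 / 2))) sums struve_L (1 / 2) w"
    unfolding struve_L_def using struve_L_half_series[OF w(1)]
    by (intro sums_mult summable_sums) (rule sums_summable)
  then have "(\<lambda>k. - (1 / (of_real (sqrt 2) * of_real pi)) * ((w / 2) powr (1 / 2 + 1) * ((w / 2) ^ (2 * k) *
      rGamma (of_nat k + 3 / 2) * rGamma (of_nat k + 1 / 2 + 3 / 2))))
      sums (- (1 / (of_real (sqrt 2) * of_real pi)) * struve_L (1 / 2) w)"
    by (rule sums_mult)
  moreover have "- (1 / (of_real (sqrt 2) * of_real pi)) * ((w / 2) powr (1 / 2 + 1) * ((w / 2) ^ (2 * k) *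
      rGamma (of_nat k + 3 / 2) * rGamma (of_nat k + 1 / 2 + 3 / 2))) =
      - residue F (of_real (3 / 4 + real k))" for k
  proof -
    have "- residue F (of_real (3 / 4 + real k)) =
      (-1) ^ k * (rGamma (of_nat k + 5 / 4) * rGamma (- 1 / 4 - of_nat k)) *
      (rGamma (of_nat k + 3 / 2) * rGamma (of_nat k + 2)) * z powr (3 / 4 + of_nat k)"
      unfolding residue_meijer_integrand
      by (simp add: prod.atLeast_Suc_lessThan add_ac minus_diff_commute)
    also have "\<dots> = (-1) ^ k * - ((-1) ^ k / (of_real (sqrt 2) * of_real pi)) *
      (rGamma (of_nat k + 3 / 2) * rGamma (of_nat k + 2)) *
      ((w / 2) powr (1 / 2 + 1) * (w / 2) ^ (2 * k))"
      unfolding rGamma_pair_eq z_def powr_of_csqrt_eq[OF w] ..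
    finally show ?thesis by (simp add: add_ac flip: power_mult_distrib)
  qed
  ultimately show ?thesis
    unfolding z_def[symmetric] by (intro meijer_G_eq_residue_series) simp
qed

section \<open>Closed forms and the final identities\<close>

text \<open>The prefactor is a multiple of \<open>w ^ 2\<close> and cancels the division by
  \<open>w ^ 2\<close> in the sum of the series.\<close>

lemma csqrt_mult_struve_H_half:
  assumes "w \<noteq> 0"
  shows "of_real (sqrt (2 * pi)) * (csqrt w * struve_H (1 / 2) w) = 2 * (1 - cos w)"
proof -
  have "csqrt w * struve_H (1 / 2) w =
      (csqrt w * (w / 2) powr (1 / 2 + 1)) * (4 / (of_real (sqrt pi) * w ^ 2) * (1 - cos w))"
    unfolding struve_H_def sums_unique[OF struve_H_half_series[OF assms], symmetric]
    by (simp only: mult.assoc)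
  also have "\<dots> = of_real (sqrt 2) / of_real (sqrt pi) * (1 - cos w)"
    unfolding powr_three_halves_mult_csqrt[OF assms] using assms by (simp add: field_simps)
  also have "of_real (sqrt (2 * pi)) * \<dots> = of_real (sqrt 2 * sqrt 2) * (1 - cos w)"
    unfolding of_real_mult by (simp add: real_sqrt_mult)
  finally show ?thesis by simp
qed

lemma csqrt_mult_struve_L_half:
  assumes "w \<noteq> 0"
  shows "of_real (sqrt (2 * pi)) * (csqrt w * struve_L (1 / 2) w) = 2 * (cosh w - 1)"
proof -
  have "csqrt w * struve_L (1 / 2) w =
      (csqrt w * (w / 2) powr (1 / 2 + 1)) * (4 / (of_real (sqrt pi) * w ^ 2) * (cosh w - 1))"
    unfolding struve_L_def sums_unique[OF struve_L_half_series[OF assms], symmetric]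
    by (simp only: mult.assoc)
  also have "\<dots> = of_real (sqrt 2) / of_real (sqrt pi) * (cosh w - 1)"
    unfolding powr_three_halves_mult_csqrt[OF assms] using assms by (simp add: field_simps)
  also have "of_real (sqrt (2 * pi)) * \<dots> = of_real (sqrt 2 * sqrt 2) * (cosh w - 1)"
    unfolding of_real_mult by (simp add: real_sqrt_mult)
  finally show ?thesis by simp
qed

text \<open>The integrals are compared through their integrands, and the last integrand is the
  derivative of the combination of \<open>V00\<close>. The first root convention gives
  \<open>csqrt (w ^ 2) = w\<close> for \<open>w = b * x\<close>, the second splits
  \<open>csqrt w\<close>.\<close>

theorem mainTheorem13:
  fixes a :: real and b :: complex
  assumes "a > 0"
  shows
    "(\<forall>\<beta> x. (V00 a \<beta> has_field_derivative exp (- of_real a * x ^ 2 - \<beta> * x)) (at x)) \<and>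
     (\<forall>x::complex. csqrt (b ^ 2 * x ^ 2) = b * x \<longrightarrow> csqrt (b * x) = csqrt b * csqrt x \<longrightarrow>
        (let I1 = of_real (sqrt (2 * pi)) *
                    (x powr (1 / 2) * exp (- of_real a * x ^ 2) * b powr (1 / 2) * struve_H (1 / 2) (b * x));
             I2 = of_real (sqrt (2 * pi)) *
                    (csqrt b * csqrt x * exp (- of_real a * x ^ 2) *
                     meijer_G 1 1 [3 / 4] [3 / 4, - 1 / 4, 1 / 4] (b ^ 2 * x ^ 2 / 4));
             I3 = - (2 * exp (- of_real a * x ^ 2) * (cos (b * x) - 1))
         in I1 = I2 \<and> I2 = I3 \<and>
            ((\<lambda>y. - V00 a (\<i> * b) y - V00 a (- \<i> * b) y + 2 * V00 a 0 y)
               has_field_derivative I3) (at x))) \<and>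
     (\<forall>x::complex. csqrt (b ^ 2 * x ^ 2) = b * x \<longrightarrow> csqrt (b * x) = csqrt b * csqrt x \<longrightarrow>
        (let J1 = of_real (sqrt (2 * pi)) *
                    (x powr (1 / 2) * exp (- of_real a * x ^ 2) * b powr (1 / 2) * struve_L (1 / 2) (b * x));
             J2 = - (2 * of_real (pi powr (3 / 2)) * csqrt b * csqrt x * exp (- of_real a * x ^ 2) *
                     meijer_G 1 1 [3 / 4, 1 / 2] [3 / 4, 1 / 2, - 1 / 4, 1 / 4] (b ^ 2 * x ^ 2 / 4));
             J3 = 2 * exp (- of_real a * x ^ 2) * sinh (b * x) + 2 * exp (- of_real a * x ^ 2 - b * x)
                  - 2 * exp (- of_real a * x ^ 2);
             J4 = 2 * exp (- of_real a * x ^ 2) * cosh (b * x) - 2 * exp (- of_real a * x ^ 2)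
         in J1 = J2 \<and> J2 = J3 \<and> J3 = J4 \<and>
            ((\<lambda>y. V00 a b y + V00 a (- b) y - 2 * V00 a 0 y) has_field_derivative J4) (at x)))"
proof (intro conjI allI impI)
  fix \<beta> x
  show "(V00 a \<beta> has_field_derivative exp (- of_real a * x ^ 2 - \<beta> * x)) (at x)"
    by (rule V00_has_field_derivative[OF assms])
next
  fix x :: complex
  assume sq: "csqrt (b ^ 2 * x ^ 2) = b * x" and split: "csqrt (b * x) = csqrt b * csqrt x"
  define E where "E = exp (- of_real a * x ^ 2)"
  define w where "w = b * x"
  have w2: "csqrt (w ^ 2) = w" using sq by (simp add: w_def power_mult_distrib)
  have bx: "b ^ 2 * x ^ 2 / 4 = w ^ 2 / 4" by (simp add: w_def power_mult_distrib)
  have roots: "x powr (1 / 2) = csqrt x" "b powr (1 / 2) = csqrt b"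
    by (simp_all only: csqrt_conv_powr)
  have cw: "csqrt w = csqrt b * csqrt x" using split by (simp add: w_def)
  \<comment> \<open>\<open>has_meijer_G\<close> requires a nonzero argument, so at
    \<open>w = 0\<close> the G-value is unspecified; there the prefactor
    \<open>csqrt b * csqrt x\<close> vanishes on both sides.\<close>
  have zero: "csqrt b * csqrt x = 0" "cos w = 1" if "w = 0"
    using that by (auto simp: w_def)
  have E_mult: "exp (- of_real a * x ^ 2 - \<beta> * x) = E * exp (- (\<beta> * x))" for \<beta>
    unfolding E_def by (simp only: diff_conv_add_uminus exp_add)
  note V00 = V00_has_field_derivative[OF assms, of _ x, unfolded E_mult]

  have I12: "struve_H (1 / 2) w = meijer_G 1 1 [3 / 4] [3 / 4, - 1 / 4, 1 / 4] (w ^ 2 / 4)" if "w \<noteq> 0"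
    using meijer_G_eq_struve_H[OF that w2] by simp
  have H: "of_real (sqrt (2 * pi)) * (csqrt b * csqrt x * struve_H (1 / 2) w) = 2 * (1 - cos w)"
    using csqrt_mult_struve_H_half[of w] zero by (cases "w = 0") (auto simp: cw)
  have HG: "csqrt b * csqrt x * struve_H (1 / 2) w =
      csqrt b * csqrt x * meijer_G 1 1 [3 / 4] [3 / 4, - 1 / 4, 1 / 4] (w ^ 2 / 4)"
    using I12 zero by (cases "w = 0") auto
  have "((\<lambda>y. - V00 a (\<i> * b) y - V00 a (- \<i> * b) y + 2 * V00 a 0 y) has_field_derivative
      - (E * exp (- (\<i> * b * x))) - E * exp (- (- \<i> * b * x)) + 2 * (E * exp (- (0 * x)))) (at x)"
    by (intro DERIV_add DERIV_diff DERIV_minus DERIV_cmult V00)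
  \<comment> \<open>Euler's formula combines the exponentials for \<open>\<i> * b\<close> and
    \<open>- \<i> * b\<close> into a cosine.\<close>
  moreover have "- (E * exp (- (\<i> * b * x))) - E * exp (- (- \<i> * b * x)) + 2 * (E * exp (- (0 * x))) =
      - (2 * E * (cos w - 1))"
    unfolding cos_exp_eq w_def by (simp add: algebra_simps)
  ultimately have deriv: "((\<lambda>y. - V00 a (\<i> * b) y - V00 a (- \<i> * b) y + 2 * V00 a 0 y)
      has_field_derivative - (2 * E * (cos w - 1))) (at x)"
    by (simp only:)
  have "of_real (sqrt (2 * pi)) * (csqrt x * E * csqrt b * struve_H (1 / 2) w) =
      of_real (sqrt (2 * pi)) * (csqrt b * csqrt x * E *
        meijer_G 1 1 [3 / 4] [3 / 4, - 1 / 4, 1 / 4] (w ^ 2 / 4))"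
    using arg_cong[OF HG, of "\<lambda>u. of_real (sqrt (2 * pi)) * E * u"] by (simp only: mult_ac)
  moreover have "of_real (sqrt (2 * pi)) * (csqrt x * E * csqrt b * struve_H (1 / 2) w) = - (2 * E * (cos w - 1))"
  proof -
    have "of_real (sqrt (2 * pi)) * (csqrt x * E * csqrt b * struve_H (1 / 2) w) =
        E * (of_real (sqrt (2 * pi)) * (csqrt b * csqrt x * struve_H (1 / 2) w))"
      by (simp only: mult_ac)
    then show ?thesis unfolding H by (simp add: algebra_simps)
  qed
  ultimately show "let I1 = of_real (sqrt (2 * pi)) *
                    (x powr (1 / 2) * exp (- of_real a * x ^ 2) * b powr (1 / 2) * struve_H (1 / 2) (b * x));
             I2 = of_real (sqrt (2 * pi)) *
                    (csqrt b * csqrt x * exp (- of_real a * x ^ 2) *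
                     meijer_G 1 1 [3 / 4] [3 / 4, - 1 / 4, 1 / 4] (b ^ 2 * x ^ 2 / 4));
             I3 = - (2 * exp (- of_real a * x ^ 2) * (cos (b * x) - 1))
         in I1 = I2 \<and> I2 = I3 \<and>
            ((\<lambda>y. - V00 a (\<i> * b) y - V00 a (- \<i> * b) y + 2 * V00 a 0 y)
               has_field_derivative I3) (at x)"
    unfolding Let_def E_def[symmetric] w_def[symmetric] roots bx using deriv by (simp only: simp_thms)
next
  fix x :: complex
  assume sq: "csqrt (b ^ 2 * x ^ 2) = b * x" and split: "csqrt (b * x) = csqrt b * csqrt x"
  define E where "E = exp (- of_real a * x ^ 2)"
  define w where "w = b * x"
  have w2: "csqrt (w ^ 2) = w" using sq by (simp add: w_def power_mult_distrib)
  have bx: "b ^ 2 * x ^ 2 / 4 = w ^ 2 / 4" by (simp add: w_def power_mult_distrib)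
  have roots: "x powr (1 / 2) = csqrt x" "b powr (1 / 2) = csqrt b"
    by (simp_all only: csqrt_conv_powr)
  have cw: "csqrt w = csqrt b * csqrt x" using split by (simp add: w_def)
  \<comment> \<open>As before, the vanishing prefactor settles \<open>w = 0\<close>.\<close>
  have zero: "csqrt b * csqrt x = 0" "cosh w = 1" if "w = 0"
    using that by (auto simp: w_def)
  have E_mult: "exp (- of_real a * x ^ 2 - \<beta> * x) = E * exp (- (\<beta> * x))" for \<beta>
    unfolding E_def by (simp only: diff_conv_add_uminus exp_add)
  note V00 = V00_has_field_derivative[OF assms, of _ x, unfolded E_mult]
  have E_w: "exp (- of_real a * x ^ 2 - w) = E * exp (- w)"
    using E_mult[of b] by (simp only: w_def)
  have cosh_w: "cosh w = (exp w + exp (- w)) / 2" and sinh_w: "sinh w = (exp w - exp (- w)) / 2"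
    by (simp_all add: cosh_def sinh_def scaleR_conv_of_real)

  have L: "of_real (sqrt (2 * pi)) * (csqrt b * csqrt x * struve_L (1 / 2) w) = 2 * (cosh w - 1)"
    using csqrt_mult_struve_L_half[of w] zero by (cases "w = 0") (auto simp: cw)
  let ?G = "meijer_G 1 1 [3 / 4, 1 / 2] [3 / 4, 1 / 2, - 1 / 4, 1 / 4] (w ^ 2 / 4)"
  \<comment> \<open>Splitting the constant in this way exposes the factor that cancels the
    denominator in \<open>meijer_G_eq_struve_L\<close>; the two minus signs cancel as well.\<close>
  have "2 * (pi powr (3 / 2)) = sqrt (2 * pi) * (sqrt 2 * pi)"
    using powr_add[of pi 1 "1 / 2"] by (simp add: powr_half_sqrt real_sqrt_mult)
  from arg_cong[OF this, of complex_of_real] have const: "2 * complex_of_real (pi powr (3 / 2)) =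
      of_real (sqrt (2 * pi)) * (of_real (sqrt 2) * of_real pi)"
    by (simp only: of_real_mult of_real_numeral)
  have "- (2 * of_real (pi powr (3 / 2)) * (csqrt b * csqrt x * ?G)) =
      of_real (sqrt (2 * pi)) * (csqrt b * csqrt x * struve_L (1 / 2) w)"
    unfolding const
    using meijer_G_eq_struve_L[OF _ w2] zero by (cases "w = 0") auto
  with L have G: "- (2 * of_real (pi powr (3 / 2)) * (csqrt b * csqrt x * ?G)) = 2 * (cosh w - 1)"
    by (simp only:)
  have "of_real (sqrt (2 * pi)) * (csqrt x * E * csqrt b * struve_L (1 / 2) w) =
      E * (of_real (sqrt (2 * pi)) * (csqrt b * csqrt x * struve_L (1 / 2) w))"
    by (simp only: mult_ac)
  then have J1: "of_real (sqrt (2 * pi)) * (csqrt x * E * csqrt b * struve_L (1 / 2) w) = 2 * E * cosh w - 2 * E"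
    unfolding L by (simp add: algebra_simps)
  have factor: "- (2 * of_real (pi powr (3 / 2)) * csqrt b * csqrt x * E * ?G) =
      E * - (2 * of_real (pi powr (3 / 2)) * (csqrt b * csqrt x * ?G))"
    by (simp only: mult_ac mult_minus_right)
  have J2: "- (2 * of_real (pi powr (3 / 2)) * csqrt b * csqrt x * E * ?G) = 2 * E * cosh w - 2 * E"
    unfolding factor G by (simp add: algebra_simps)
  \<comment> \<open>This rests on \<open>sinh w + exp (- w) = cosh w\<close>.\<close>
  have J3: "2 * E * sinh w + 2 * (E * exp (- w)) - 2 * E = 2 * E * cosh w - 2 * E"
    unfolding cosh_w sinh_w by (simp add: field_simps)
  have "((\<lambda>y. V00 a b y + V00 a (- b) y - 2 * V00 a 0 y) has_field_derivative
      E * exp (- (b * x)) + E * exp (- (- b * x)) - 2 * (E * exp (- (0 * x)))) (at x)"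
    by (intro DERIV_add DERIV_diff DERIV_cmult V00)
  moreover have "E * exp (- (b * x)) + E * exp (- (- b * x)) - 2 * (E * exp (- (0 * x))) = 2 * E * cosh w - 2 * E"
    unfolding cosh_w by (simp add: w_def field_simps)
  ultimately have deriv: "((\<lambda>y. V00 a b y + V00 a (- b) y - 2 * V00 a 0 y)
      has_field_derivative 2 * E * cosh w - 2 * E) (at x)"
    by (simp only:)
  show "let J1 = of_real (sqrt (2 * pi)) *
                    (x powr (1 / 2) * exp (- of_real a * x ^ 2) * b powr (1 / 2) * struve_L (1 / 2) (b * x));
             J2 = - (2 * of_real (pi powr (3 / 2)) * csqrt b * csqrt x * exp (- of_real a * x ^ 2) *
                     meijer_G 1 1 [3 / 4, 1 / 2] [3 / 4, 1 / 2, - 1 / 4, 1 / 4] (b ^ 2 * x ^ 2 / 4));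
             J3 = 2 * exp (- of_real a * x ^ 2) * sinh (b * x) + 2 * exp (- of_real a * x ^ 2 - b * x)
                  - 2 * exp (- of_real a * x ^ 2);
             J4 = 2 * exp (- of_real a * x ^ 2) * cosh (b * x) - 2 * exp (- of_real a * x ^ 2)
         in J1 = J2 \<and> J2 = J3 \<and> J3 = J4 \<and>
            ((\<lambda>y. V00 a b y + V00 a (- b) y - 2 * V00 a 0 y) has_field_derivative J4) (at x)"
    unfolding Let_def E_def[symmetric] w_def[symmetric] roots bx E_w J1 J2 J3 using deriv by blast
qed

end
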